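(* Let $n_r \geq n\ge 1$ and let $\{H_i\}_{i\in\mathbb{Z}}$ be a random process with $H_i \in M_{n_r\times n}(\mathbb{C})$ full-rank with probability $1$. Suppose that the weak law of large numbers holds for the random variables $\log\det(H_i^\dagger H_i)$, i.e. there exists $\mu>0$ such that for all $\epsilon>0$ $$\lim_{k\to\infty}\mathbb{P}\left\{\left|\frac1k\sum_{i=1}^k\log\det(H_i^\dagger H_i)-\mu\right|>\epsilon\right\}=0.$$ Let $L_{n,k}\subset M_{n\times nk}(\mathbb{C})$ be a family of $2n^2k$-dimensional lattices (with $k\to\infty$) such that, for some constant $C_L>0$ independent of $k$, $$\det\nolimits_{\min}(L_{n,k})=1\quad\text{and}\quad \mathrm{Vol}(L_{n,k})^{\frac{1}{n^2k}}\le C_L .$$ Then, for power constraint $P>0$, any rate $$R<\mu+n\left(\log P-\log C_L+\log\frac{\pi e}{4n^2}\right)$$ is achievable over the $(n,n_r,k)$-multiblock channel with fading $\{H_i\}$ using the codes built from $L_{n,k}$, both with maximum likelihood decoding and with naive lattice decoding.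
   Context: $\log$ is the base-2 logarithm. $\|\cdot\|$ is the Frobenius norm. Channel: in the $(n,n_r,k)$-multiblock channel a codeword $X=(X_1,\dots,X_k)\in M_{n\times nk}(\mathbb{C})$, $X_i\in M_n(\mathbb{C})$, is received as $Y_i=H_iX_i+W_i$, $i=1,\dots,k$, where $H_i\in M_{n_r\times n}(\mathbb{C})$ and the entries of the $W_i\in M_{n_r\times n}(\mathbb{C})$ are i.i.d. circularly symmetric complex Gaussian with mean $0$ and variance $1$ per complex dimension, independent of the $H_i$ and of $X$. The receiver (not the transmitter) knows $H_1,\dots,H_k$ and decodes after all $k$ blocks. Lattices: $M_{n\times nk}(\mathbb{C})$ is a $2n^2k$-dimensional real space with inner product $\langle X,Y\rangle=\Re(\mathrm{Tr}(XY^\dagger))$. A lattice is the $\mathbb{Z}$-span of $\mathbb{R}$-linearly independent matrices; its dimension is the number of these; $\mathrm{Vol}(L)$ is the square root of the determinant of the Gram matrix of a basis. For $X=(X_1,\dots,X_k)$ put $\mathrm{pdet}(X)=\prod_{i=1}^k\det(X_i)$ and $\det_{\min}(L)=\inf_{X\in L\setminus\{0\}}|\mathrm{pdet}(X)|$. The index $k$ ranges over some infinite set of positive integers. Codes: given $P>0$ and a rate $R$, let $C_{n,k}=\frac{(\pi nk)^{n^2k}}{(n^2k)!}$ and $\alpha>0$ be given by $\alpha^2=\frac{C_{n,k}^{1/(n^2k)}P}{2^{R/n}\mathrm{Vol}(L_{n,k})^{1/(n^2k)}}$. Let $B(r)$ be the set of matrices in $M_{n\times nk}(\mathbb{C})$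 of Frobenius norm at most $r$. The code is $\mathcal{C}=B(\sqrt{Pkn})\cap(X_R+\alpha L_{n,k})$, where the shift $X_R\in M_{n\times nk}(\mathbb{C})$ is chosen so that $|\mathcal{C}|\ge 2^{Rnk}$ (such a shift exists). Thus every codeword satisfies $\frac1{nk}\|X\|^2\le P$, and the rate is at least $R$ bits per complex channel use. Decoding: maximum likelihood decoding outputs a minimizer of $\sum_{i=1}^k\|Y_i-H_iX_i'\|^2$ over $X'\in\mathcal{C}$; naive lattice decoding minimizes the same quantity over the whole infinite shifted lattice $X_R+\alpha L_{n,k}$. $P_e$ is the probability that the output differs from the transmitted codeword (uniform in $\mathcal{C}$). A rate $R$ is achievable if $P_e\to0$ as $k\to\infty$. *)

theory Defs
  imports "HOL-Probability.Probability" "Jordan_Normal_Form.Determinant"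
begin

text \<open>
  An element of \<open>M_{n \<times> nk}(\<complex>)\<close> is a tuple of \<open>k\<close> square blocks: a function on \<open>{1..k}\<close>,
  \<open>undefined\<close> elsewhere, so that these tuples form the space of a finite product measure.
  Block sizes are types, \<open>n = CARD('n)\<close> and \<open>n\<^sub>r = CARD('r)\<close>. Square matrices of size depending
  on \<open>k\<close> (Gram matrices) are taken from \<open>Jordan_Normal_Form\<close>.
\<close>

type_synonym 'n blocks = "nat \<Rightarrow> complex^'n^'n"
type_synonym ('n, 'r) rblocks = "nat \<Rightarrow> complex^'n^'r"

definition block_space :: "nat \<Rightarrow> (nat \<Rightarrow> 'a) set" where
  "block_space k = {1..k} \<rightarrow>\<^sub>E UNIV"

definition zero_block :: "nat \<Rightarrow> 'n::finite blocks" where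
  "zero_block k = (\<lambda>i\<in>{1..k}. 0)"

definition conj_transpose :: "complex^'n^'m \<Rightarrow> complex^'m^'n" where
  "conj_transpose A = map_matrix cnj (transpose A)"

text \<open>\<open>\<Re>(Tr(X Y\<^sup>\<dagger>))\<close>, computed blockwise.\<close>

definition block_inner :: "nat \<Rightarrow> 'n::finite blocks \<Rightarrow> 'n blocks \<Rightarrow> real" where
  "block_inner k X Y = Re (\<Sum>i=1..k. trace (X i ** conj_transpose (Y i)))"

text \<open>The library norm on \<^typ>\<open>complex^'n^'m\<close> is the Frobenius norm.\<close>

definition block_norm :: "nat \<Rightarrow> 'n::finite blocks \<Rightarrow> real" where
  "block_norm k X = L2_set (\<lambda>i. norm (X i)) {1..k}"

definition pdet :: "nat \<Rightarrow> 'n::finite blocks \<Rightarrow> complex" where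
  "pdet k X = (\<Prod>i=1..k. Determinants.det (X i))"


definition lattice_basis :: "nat \<Rightarrow> nat \<Rightarrow> (nat \<Rightarrow> 'n::finite blocks) \<Rightarrow> 'n blocks set \<Rightarrow> bool" where
  "lattice_basis k d b L \<longleftrightarrow>
     (\<forall>j<d. b j \<in> block_space k) \<and>
     (\<forall>c :: nat \<Rightarrow> real. (\<forall>i\<in>{1..k}. (\<Sum>j<d. c j *\<^sub>R b j i) = 0) \<longrightarrow> (\<forall>j<d. c j = 0)) \<and>
     L = {\<lambda>i\<in>{1..k}. \<Sum>j<d. real_of_int (z j) *\<^sub>R b j i | z :: nat \<Rightarrow> int. True}"

definition is_lattice :: "nat \<Rightarrow> nat \<Rightarrow> 'n::finite blocks set \<Rightarrow> bool" where
  "is_lattice k d L \<longleftrightarrow> (\<exists>b. lattice_basis k d b L)"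

definition gram_det :: "nat \<Rightarrow> nat \<Rightarrow> (nat \<Rightarrow> 'n::finite blocks) \<Rightarrow> real" where
  "gram_det k d b = Determinant.det (Matrix.mat d d (\<lambda>(i, j). block_inner k (b i) (b j)))"

text \<open>The value does not depend on the basis chosen.\<close>

definition lattice_vol :: "nat \<Rightarrow> nat \<Rightarrow> 'n::finite blocks set \<Rightarrow> real" where
  "lattice_vol k d L = sqrt (gram_det k d (SOME b. lattice_basis k d b L))"

definition det_min :: "nat \<Rightarrow> 'n::finite blocks set \<Rightarrow> real" where
  "det_min k L = (INF X\<in>L - {zero_block k}. cmod (pdet k X))"


definition C_nk :: "nat \<Rightarrow> nat \<Rightarrow> real" where
  "C_nk n k = (pi * real n * real k) ^ (n\<^sup>2 * k) / fact (n\<^sup>2 * k)"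

definition scaling :: "real \<Rightarrow> real \<Rightarrow> nat \<Rightarrow> 'n::finite blocks set \<Rightarrow> real" where
  "scaling P R k L =
     (let n = CARD('n); e = 1 / (real n ^ 2 * real k)
      in sqrt ((C_nk n k powr e * P) /
               (2 powr (R / real n) * lattice_vol k (2 * n\<^sup>2 * k) L powr e)))"

definition shifted_lattice ::
  "real \<Rightarrow> real \<Rightarrow> nat \<Rightarrow> 'n::finite blocks set \<Rightarrow> 'n blocks \<Rightarrow> 'n blocks set" where
  "shifted_lattice P R k L XR =
     (\<lambda>l. \<lambda>i\<in>{1..k}. XR i + scaling P R k L *\<^sub>R l i) ` L"

definition code ::
  "real \<Rightarrow> real \<Rightarrow> nat \<Rightarrow> 'n::finite blocks set \<Rightarrow> 'n blocks \<Rightarrow> 'n blocks set" where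
  "code P R k L XR =
     {X \<in> shifted_lattice P R k L XR. block_norm k X \<le> sqrt (P * real k * real CARD('n))}"

definition good_shift ::
  "real \<Rightarrow> real \<Rightarrow> nat \<Rightarrow> 'n::finite blocks set \<Rightarrow> 'n blocks \<Rightarrow> bool" where
  "good_shift P R k L XR \<longleftrightarrow>
     XR \<in> block_space k \<and>
     2 powr (R * real CARD('n) * real k) \<le> real (card (code P R k L XR))"


text \<open>
  Circularly symmetric complex Gaussian of variance 1: independent real and imaginary parts,
  each of variance \<open>1/2\<close> (\<^const>\<open>normal_density\<close> takes the standard deviation).
\<close>

definition complex_gaussian :: "complex measure" where
  "complex_gaussian =
     (let g = density lborel (normal_density 0 (sqrt (1/2)))
      in distr (g \<Otimes>\<^sub>M g) borel (\<lambda>(x, y). Complex x y))"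

definition noise :: "nat \<Rightarrow> (nat \<times> 'r::finite \<times> 'n::finite \<Rightarrow> complex) measure" where
  "noise k = PiM ({1..k} \<times> UNIV \<times> UNIV) (\<lambda>_. complex_gaussian)"

definition channel_output ::
  "nat \<Rightarrow> ('n::finite, 'r::finite) rblocks \<Rightarrow> (nat \<times> 'r \<times> 'n \<Rightarrow> complex) \<Rightarrow> 'n blocks \<Rightarrow> ('n, 'r) rblocks"
  where
  "channel_output k h w X = (\<lambda>i\<in>{1..k}. h i ** X i + (\<chi> a b. w (i, a, b)))"

definition decoding_metric ::
  "nat \<Rightarrow> ('n::finite, 'r::finite) rblocks \<Rightarrow> ('n, 'r) rblocks \<Rightarrow> 'n blocks \<Rightarrow> real" where
  "decoding_metric k h y X' = (\<Sum>i=1..k. (norm (y i - h i ** X' i))\<^sup>2)"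

text \<open>
  A decoder sees the fading \<open>h\<close> and the output \<open>y\<close>, and returns some minimizer over \<open>S\<close>; ties may
  be broken in any measurable way. If \<open>S\<close> is infinite and some block of \<open>h\<close> is not of full rank, a
  minimizer need not exist; the output is then unconstrained.
\<close>

definition min_decoder ::
  "nat \<Rightarrow> 'n::finite blocks set \<Rightarrow> (('n, 'r::finite) rblocks \<times> ('n, 'r) rblocks \<Rightarrow> 'n blocks) \<Rightarrow> bool"
  where
  "min_decoder k S D \<longleftrightarrow>
     D \<in> PiM {1..k} (\<lambda>_. borel) \<Otimes>\<^sub>M PiM {1..k} (\<lambda>_. borel) \<rightarrow>\<^sub>M PiM {1..k} (\<lambda>_. borel) \<and>
     (\<forall>h\<in>block_space k. \<forall>y\<in>block_space k.
        (\<exists>X. is_arg_min (decoding_metric k h y) (\<lambda>X'. X' \<in> S) X) \<longrightarrow>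
        is_arg_min (decoding_metric k h y) (\<lambda>X'. X' \<in> S) (D (h, y)))"

text \<open>Fading, noise and the uniformly distributed codeword are independent: a product measure.\<close>

definition error_prob ::
  "'w measure \<Rightarrow> (int \<Rightarrow> 'w \<Rightarrow> complex^'n::finite^'r::finite) \<Rightarrow> nat \<Rightarrow> 'n blocks set \<Rightarrow>
   (('n, 'r) rblocks \<times> ('n, 'r) rblocks \<Rightarrow> 'n blocks) \<Rightarrow> real" where
  "error_prob M H k C D =
     \<P>((\<omega>, w, X) in M \<Otimes>\<^sub>M noise k \<Otimes>\<^sub>M uniform_count_measure C.
        (let h = (\<lambda>i\<in>{1..k}. H (int i) \<omega>) in D (h, channel_output k h w X) \<noteq> X))"

text \<open>
  \<open>S k X\<^sub>R\<close> is the set searched by the decoder when the shift is \<open>X\<^sub>R\<close>. Admissible shifts exist,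
  and for every choice of them and of minimizing decoders the error probability vanishes as
  \<open>k \<rightarrow> \<infinity>\<close> within \<open>K\<close>.
\<close>

definition achievable_by ::
  "'w measure \<Rightarrow> (int \<Rightarrow> 'w \<Rightarrow> complex^'n::finite^'r::finite) \<Rightarrow> real \<Rightarrow> nat set \<Rightarrow>
   (nat \<Rightarrow> 'n blocks set) \<Rightarrow> (nat \<Rightarrow> 'n blocks \<Rightarrow> 'n blocks set) \<Rightarrow> real \<Rightarrow> bool" where
  "achievable_by M H P K L S R \<longleftrightarrow>
     (\<forall>k\<in>K. \<exists>XR. good_shift P R k (L k) XR) \<and>
     (\<forall>XR D. (\<forall>k\<in>K. good_shift P R k (L k) (XR k) \<and> min_decoder k (S k (XR k)) (D k)) \<longrightarrow>
        ((\<lambda>k. error_prob M H k (code P R k (L k) (XR k)) (D k)) \<longlongrightarrow> 0)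
          (inf sequentially (principal K)))"

definition achievable_ML ::
  "'w measure \<Rightarrow> (int \<Rightarrow> 'w \<Rightarrow> complex^'n::finite^'r::finite) \<Rightarrow> real \<Rightarrow> nat set \<Rightarrow>
   (nat \<Rightarrow> 'n blocks set) \<Rightarrow> real \<Rightarrow> bool" where
  "achievable_ML M H P K L R \<longleftrightarrow>
     achievable_by M H P K L (\<lambda>k XR. code P R k (L k) XR) R"

definition achievable_NLD ::
  "'w measure \<Rightarrow> (int \<Rightarrow> 'w \<Rightarrow> complex^'n::finite^'r::finite) \<Rightarrow> real \<Rightarrow> nat set \<Rightarrow>
   (nat \<Rightarrow> 'n blocks set) \<Rightarrow> real \<Rightarrow> bool" where
  "achievable_NLD M H P K L R \<longleftrightarrow>
     achievable_by M H P K L (\<lambda>k XR. shifted_lattice P R k (L k) XR) R"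

end

theory Submission
  imports Defs "HOL-Real_Asymp.Real_Asymp"
begin

no_notation Matrix.vec_index (infixl \<open>$\<close> 100)
no_notation Matrix.scalar_prod (infix \<open>\<bullet>\<close> 70)
hide_const (open) Matrix.row Matrix.rows Matrix.mat Matrix.vec Matrix.orthogonal Determinant.det

text \<open>
  A shift exists by averaging: the mean number of points of a uniformly shifted lattice in a ball
  is the ratio of the volumes, which the choice of \<open>\<alpha>\<close> makes equal to \<open>2\<^bsup>Rnk\<^esup>\<close>.

  A transmitted \<open>X\<close> is the unique minimizer over the whole shifted lattice as soon as
  \<open>2 \<langle>W, H l\<rangle> < \<alpha> \<parallel>H l\<parallel>\<^sup>2\<close> for all nonzero lattice points \<open>l\<close>; this settles both decoders at once.
  By Hadamard's inequality and the AM-GM inequality,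
  \<open>\<parallel>H l\<parallel>\<^sup>2 \<ge> nk (\<Prod>\<^sub>i det (H\<^sub>i\<^sup>\<dagger> H\<^sub>i))\<^bsup>1/(nk)\<^esup>\<close>, because \<open>\<bar>pdet l\<bar> \<ge> 1\<close>. Only the component of
  \<open>W\<^sub>i\<close> in the range of \<open>Z \<mapsto> H\<^sub>i Z\<close> matters; that range has real dimension at most \<open>2n\<^sup>2\<close>, so the
  squared norm of the projected noise has mean at most \<open>n\<^sup>2k\<close> and variance \<open>O(k)\<close>, uniformly in \<open>H\<close>,
  and Chebyshev's inequality applies. This is why \<open>n\<^sub>r\<close> does not enter the rate.
\<close>

section \<open>Volumes of ellipsoids\<close>

text \<open>Origin of the constant in the rate. Cauchy-Schwarz reduces the decoding condition to
  \<open>4 * Z < \<alpha>^2 * q\<close>, where Z is the squared norm of the projected noise and q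
  that of H l. Typically Z is at most about n^2 k and q is at least n k T with T about 2^(\<mu>/n),
  so 4 n < \<alpha>^2 T suffices. With N = n^2 k, Stirling's formula shows that the N-th root of
  \<open>C_nk\<close> tends to pi e / n, so \<alpha>^2 is essentially at least pi e P / (n 2^(R/n)
  \<open>C\<^sub>L\<close>). Solving for R produces 4 n^2. Infinitely many competitors are handled
  at once: Z does not depend on l, so a single noise event covers all nonzero lattice points, and
  the determinant bound on q is uniform in l. Volumes and lattice points are counted in coefficient
  space, with respect to the very basis that \<open>lattice_vol\<close> selects. There the lattice
  is the integer grid, the ball is an ellipsoid of the Gram form, and the covolume enters as the
  square root of the Gram determinant.\<close>

definition quad_form :: "nat \<Rightarrow> (nat \<Rightarrow> nat \<Rightarrow> real) \<Rightarrow> (nat \<Rightarrow> real) \<Rightarrow> real" where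
  "quad_form d G x = (\<Sum>i<d. \<Sum>j<d. G i j * x i * x j)"

definition pos_def :: "nat \<Rightarrow> (nat \<Rightarrow> nat \<Rightarrow> real) \<Rightarrow> bool" where
  "pos_def d G \<longleftrightarrow> (\<forall>i<d. \<forall>j<d. G i j = G j i) \<and> (\<forall>x. (\<exists>i<d. x i \<noteq> 0) \<longrightarrow> 0 < quad_form d G x)"

text \<open>Elimination of the pivot \<open>G d d\<close>. Matrices are plain functions of which
  only the leading block is read, so the dimension can drop in an induction without a change of
  type.\<close>

definition schur :: "nat \<Rightarrow> (nat \<Rightarrow> nat \<Rightarrow> real) \<Rightarrow> nat \<Rightarrow> nat \<Rightarrow> real" where
  "schur d G i j = G i j - G i d * G d j / G d d"

text \<open>One elimination step: right multiplication by the unit lower triangular block matrix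
  \<open>?E\<close> clears the last row except for the pivot.\<close>

lemma det_schur:
  assumes "G d d \<noteq> 0"
  shows "Determinant.det (Matrix.mat (Suc d) (Suc d) (\<lambda>(i, j). G i j)) =
    G d d * Determinant.det (Matrix.mat d d (\<lambda>(i, j). schur d G i j))"
proof -
  let ?C = "Matrix.mat d 1 (\<lambda>(i, j). G i d)"
  let ?A = "four_block_mat (Matrix.mat d d (\<lambda>(i, j). G i j)) ?C
      (Matrix.mat 1 d (\<lambda>(i, j). G d j)) (Matrix.mat 1 1 (\<lambda>_. G d d))"
  let ?E = "four_block_mat (1\<^sub>m d) (0\<^sub>m d 1) (Matrix.mat 1 d (\<lambda>(i, j). - G d j / G d d)) (1\<^sub>m 1)"
  have A: "Matrix.mat (Suc d) (Suc d) (\<lambda>(i, j). G i j) = ?A"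
    by (rule eq_matI) (auto simp: less_Suc_eq)
  have "?A * ?E = four_block_mat (Matrix.mat d d (\<lambda>(i, j). schur d G i j)) ?C
      (0\<^sub>m 1 d) (Matrix.mat 1 1 (\<lambda>_. G d d))"
    apply (subst mult_four_block_mat[of _ d d _ 1 _ 1], auto, intro cong_four_block_mat)
    subgoal by (rule eq_matI) (auto simp: scalar_prod_def schur_def)
    subgoal by (rule eq_matI) (auto simp: scalar_prod_def)
    subgoal using assms by (intro eq_matI) (auto simp: scalar_prod_def)
    subgoal by (rule eq_matI) (auto simp: scalar_prod_def)
    done
  moreover have "Determinant.det (?A * ?E) = Determinant.det ?A * Determinant.det ?E"
    by (rule det_mult[where n = "Suc d"]) auto
  moreover have "Determinant.det ?E = 1"
    by (subst det_four_block_mat_upper_right_zero) auto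
  moreover have "Determinant.det (four_block_mat (Matrix.mat d d (\<lambda>(i, j). schur d G i j)) ?C
      (0\<^sub>m 1 d) (Matrix.mat 1 1 (\<lambda>_. G d d))) =
      Determinant.det (Matrix.mat d d (\<lambda>(i, j). schur d G i j)) * G d d"
    by (subst det_four_block_mat_lower_left_zero) (auto simp: det_single)
  ultimately show ?thesis
    unfolding A by simp
qed

text \<open>Completing the square in the last variable; what remains is the form of the Schur
  complement.\<close>

lemma quad_form_schur:
  assumes "\<And>i. i < d \<Longrightarrow> G i d = G d i" and "G d d \<noteq> 0"
  shows "quad_form (Suc d) G x =
    G d d * (x d + (\<Sum>i<d. G d i * x i) / G d d)\<^sup>2 + quad_form d (schur d G) x"
proof -
  let ?g = "\<Sum>i<d. G d i * x i"
  have "(\<Sum>i<d. G i d * x i * x d) = ?g * x d"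
    using assms(1) by (simp add: sum_distrib_right)
  moreover have "(\<Sum>j<d. G d j * x d * x j) = ?g * x d"
    by (simp add: sum_distrib_left mult_ac)
  ultimately have "quad_form (Suc d) G x = quad_form d G x + 2 * (?g * x d) + G d d * (x d)\<^sup>2"
    by (simp add: quad_form_def sum.distrib power2_eq_square mult_ac)
  moreover have "(\<Sum>i<d. \<Sum>j<d. G i d * G d j / G d d * x i * x j) = ?g * ?g / G d d"
    unfolding sum_product using assms
    by (auto simp: sum_divide_distrib intro!: sum.cong)
  then have "quad_form d (schur d G) x = quad_form d G x - ?g * ?g / G d d"
    by (simp add: quad_form_def schur_def left_diff_distrib sum_subtractf)
  moreover have "G d d * (x d + ?g / G d d)\<^sup>2 = G d d * (x d)\<^sup>2 + 2 * (?g * x d) + ?g * ?g / G d d"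
    using assms(2) by (simp add: field_simps power2_eq_square)
  ultimately show ?thesis
    by simp
qed

lemma quad_form_cong: "(\<And>i. i < d \<Longrightarrow> x i = y i) \<Longrightarrow> quad_form d G x = quad_form d G y"
  unfolding quad_form_def by (intro sum.cong refl) auto

lemma pos_def_diag:
  assumes "pos_def (Suc d) G"
  shows "0 < G d d"
proof -
  have "0 < quad_form (Suc d) G (\<lambda>i. if i = d then 1 else 0)"
    using assms unfolding pos_def_def by auto
  then show ?thesis
    by (simp add: quad_form_def)
qed

lemma pos_def_schur:
  assumes "pos_def (Suc d) G"
  shows "pos_def d (schur d G)"
  unfolding pos_def_def
proof (intro conjI allI impI)
  note pos = pos_def_diag[OF assms]
  have sym: "G i j = G j i" if "i < Suc d" "j < Suc d" for i j
    using assms that by (auto simp: pos_def_def)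
  show "schur d G i j = schur d G j i" if "i < d" "j < d" for i j
    using that sym[of i j] sym[of i d] sym[of j d] by (simp add: schur_def mult.commute)
  fix x :: "nat \<Rightarrow> real"
  assume nz: "\<exists>i<d. x i \<noteq> 0"
  \<comment> \<open>The last coordinate is chosen to annihilate the completed square, so that the
    two forms agree at \<open>y\<close> and \<open>x\<close>.\<close>
  define y where "y = x(d := - (\<Sum>i<d. G d i * x i) / G d d)"
  have "0 < quad_form (Suc d) G y"
  proof -
    from nz obtain i where "i < d" "x i \<noteq> 0" by blast
    then have "i < Suc d" "y i \<noteq> 0" by (auto simp: y_def)
    then show ?thesis using assms unfolding pos_def_def by blast
  qed
  also have "\<dots> = G d d * (y d + (\<Sum>i<d. G d i * y i) / G d d)\<^sup>2 + quad_form d (schur d G) y"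
    using pos sym by (intro quad_form_schur) auto
  also have "(\<Sum>i<d. G d i * y i) = (\<Sum>i<d. G d i * x i)"
    by (simp add: y_def)
  also have "quad_form d (schur d G) y = quad_form d (schur d G) x"
    by (rule quad_form_cong) (simp add: y_def)
  finally show "0 < quad_form d (schur d G) x"
    by (simp add: y_def)
qed

text \<open>The determinant is the product of the successive pivots, all of them positive.\<close>

lemma det_pos_def: "pos_def d G \<Longrightarrow> 0 < Determinant.det (Matrix.mat d d (\<lambda>(i, j). G i j))"
proof (induction d arbitrary: G)
  case (Suc d)
  then show ?case
    using det_schur[of G d] pos_def_diag pos_def_schur by fastforce
qed simp

lemma measurable_quad_form [measurable]:
  "quad_form d G \<in> borel_measurable (PiM {..<d} (\<lambda>_. lborel))"
  unfolding quad_form_def by measurable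

text \<open>A linear change of variables done one coordinate at a time: after completing the square,
  the last variable is translated and rescaled by \<open>sqrt (G d d)\<close>. The integral over it
  is again a function of the remaining form, which is why the induction needs arbitrary
  \<open>F\<close> and not only indicators.\<close>

lemma nn_integral_quad_form:
  fixes F :: "real \<Rightarrow> ennreal"
  assumes "pos_def d G" and [measurable]: "F \<in> borel_measurable borel"
  shows "(\<integral>\<^sup>+ x. F (quad_form d G x) \<partial>PiM {..<d} (\<lambda>_. lborel)) =
    ennreal (1 / sqrt (Determinant.det (Matrix.mat d d (\<lambda>(i, j). G i j)))) *
    (\<integral>\<^sup>+ x. F (\<Sum>i<d. (x i)\<^sup>2) \<partial>PiM {..<d} (\<lambda>_. lborel))"
  using assms
proof (induction d arbitrary: G F)
  case 0
  then show ?case by (simp add: quad_form_def)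
next
  case (Suc d)
  note [measurable] = Suc.prems(2)
  interpret lborel_product: product_sigma_finite "\<lambda>_::nat. lborel :: real measure"
    by standard
  let ?M = "PiM {..<d} (\<lambda>_. lborel :: real measure)"
  let ?S = "schur d G"
  let ?D = "Determinant.det (Matrix.mat d d (\<lambda>(i, j). ?S i j))"
  let ?g = "G d d"
  have g: "0 < ?g" using Suc.prems by (intro pos_def_diag)
  have S: "pos_def d ?S" using Suc.prems by (intro pos_def_schur)
  have D: "0 < ?D" using det_pos_def[OF S] .
  have sym: "G i d = G d i" if "i < d" for i
    using Suc.prems that by (auto simp: pos_def_def)
  have ins: "{..<Suc d} = insert d {..<d}" by auto
  have q: "quad_form (Suc d) G (x(d := t)) =
      (sqrt ?g * (t + (\<Sum>i<d. G d i * x i) / ?g))\<^sup>2 + quad_form d ?S x" for x t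
    by (subst quad_form_schur)
      (use g sym in \<open>auto simp: power_mult_distrib intro!: sum.cong quad_form_cong\<close>)
  have [measurable]: "quad_form d ?S \<in> borel_measurable ?M" by measurable
  have "(\<integral>\<^sup>+ x. F (quad_form (Suc d) G x) \<partial>PiM {..<Suc d} (\<lambda>_. lborel)) =
      (\<integral>\<^sup>+ x. (\<integral>\<^sup>+ t. F (quad_form (Suc d) G (x(d := t))) \<partial>lborel) \<partial>?M)"
    unfolding ins
    by (subst lborel_product.product_nn_integral_insert)
      (auto simp: ins[symmetric])
  also have "\<dots> = (\<integral>\<^sup>+ x. ennreal (1 / sqrt ?g) * (\<integral>\<^sup>+ t. F (t\<^sup>2 + quad_form d ?S x) \<partial>lborel) \<partial>?M)"
  proof (intro nn_integral_cong)
    fix x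
    let ?c = "(\<Sum>i<d. G d i * x i) / ?g"
    let ?J = "\<integral>\<^sup>+ t. F ((sqrt ?g * (t + ?c))\<^sup>2 + quad_form d ?S x) \<partial>lborel"
    have "(\<integral>\<^sup>+ t. F (t\<^sup>2 + quad_form d ?S x) \<partial>lborel) =
        ennreal \<bar>sqrt ?g\<bar> * (\<integral>\<^sup>+ t. F ((sqrt ?g * ?c + sqrt ?g * t)\<^sup>2 + quad_form d ?S x) \<partial>lborel)"
      using g by (intro nn_integral_real_affine) auto
    moreover have "(\<lambda>t. sqrt ?g * ?c + sqrt ?g * t) = (\<lambda>t. sqrt ?g * (t + ?c))"
      by (simp only: distrib_left add.commute)
    ultimately have J: "(\<integral>\<^sup>+ t. F (t\<^sup>2 + quad_form d ?S x) \<partial>lborel) = ennreal (sqrt ?g) * ?J"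
      using g by (simp add: fun_eq_iff)
    have "ennreal (1 / sqrt ?g) * (ennreal (sqrt ?g) * ?J) = ?J"
      by (subst mult.assoc[symmetric], subst ennreal_mult[symmetric]) (use g in auto)
    then show "(\<integral>\<^sup>+ t. F (quad_form (Suc d) G (x(d := t))) \<partial>lborel) =
        ennreal (1 / sqrt ?g) * (\<integral>\<^sup>+ t. F (t\<^sup>2 + quad_form d ?S x) \<partial>lborel)"
      unfolding q J by simp
  qed
  also have "\<dots> = ennreal (1 / sqrt ?g) *
      (\<integral>\<^sup>+ x. (\<integral>\<^sup>+ t. F (t\<^sup>2 + quad_form d ?S x) \<partial>lborel) \<partial>?M)"
    by (intro nn_integral_cmult) measurable
  also have "(\<integral>\<^sup>+ x. (\<integral>\<^sup>+ t. F (t\<^sup>2 + quad_form d ?S x) \<partial>lborel) \<partial>?M) =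
      (\<integral>\<^sup>+ x. ennreal (1 / sqrt ?D) * (\<integral>\<^sup>+ t. F (t\<^sup>2 + (\<Sum>i<d. (x i)\<^sup>2)) \<partial>lborel) \<partial>?M)"
  proof (subst Suc.IH[where F = "\<lambda>u. \<integral>\<^sup>+ t. F (t\<^sup>2 + u) \<partial>lborel"])
    show "(\<lambda>u. \<integral>\<^sup>+ t. F (t\<^sup>2 + u) \<partial>lborel) \<in> borel_measurable borel"
      by measurable
  qed (auto simp: S nn_integral_cmult)
  also have "\<dots> = ennreal (1 / sqrt ?D) *
      (\<integral>\<^sup>+ x. (\<integral>\<^sup>+ t. F (t\<^sup>2 + (\<Sum>i<d. (x i)\<^sup>2)) \<partial>lborel) \<partial>?M)"
    by (intro nn_integral_cmult) measurable
  also have "(\<integral>\<^sup>+ x. (\<integral>\<^sup>+ t. F (t\<^sup>2 + (\<Sum>i<d. (x i)\<^sup>2)) \<partial>lborel) \<partial>?M) =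
      (\<integral>\<^sup>+ x. (\<integral>\<^sup>+ t. F (\<Sum>i<Suc d. ((x(d := t)) i)\<^sup>2) \<partial>lborel) \<partial>?M)"
    by (intro nn_integral_cong arg_cong[where f = F]) (auto intro!: sum.cong)
  also have "\<dots> = (\<integral>\<^sup>+ x. F (\<Sum>i<Suc d. (x i)\<^sup>2) \<partial>PiM {..<Suc d} (\<lambda>_. lborel))"
    unfolding ins
    by (subst lborel_product.product_nn_integral_insert)
      (auto simp: ins[symmetric])
  finally have "(\<integral>\<^sup>+ x. F (quad_form (Suc d) G x) \<partial>PiM {..<Suc d} (\<lambda>_. lborel)) =
      ennreal (1 / sqrt ?g) * (ennreal (1 / sqrt ?D) *
      (\<integral>\<^sup>+ x. F (\<Sum>i<Suc d. (x i)\<^sup>2) \<partial>PiM {..<Suc d} (\<lambda>_. lborel)))" .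
  moreover have "ennreal (1 / sqrt ?g) * ennreal (1 / sqrt ?D) = ennreal (1 / sqrt (?g * ?D))"
    using g D by (simp add: real_sqrt_mult ennreal_mult[symmetric])
  moreover have "Determinant.det (Matrix.mat (Suc d) (Suc d) (\<lambda>(i, j). G i j)) = ?g * ?D"
    using g by (intro det_schur) auto
  ultimately show ?case
    by (simp only: mult.assoc[symmetric])
qed

lemma emeasure_ellipsoid:
  assumes "pos_def d G" and "r > 0"
  shows "emeasure (PiM {..<d} (\<lambda>_. lborel))
      {x \<in> space (PiM {..<d} (\<lambda>_. lborel)). quad_form d G x \<le> r\<^sup>2} =
    ennreal (unit_ball_vol (real d) * r ^ d /
      sqrt (Determinant.det (Matrix.mat d d (\<lambda>(i, j). G i j))))"
proof -
  let ?M = "PiM {..<d} (\<lambda>_. lborel :: real measure)"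
  have "emeasure ?M {x \<in> space ?M. quad_form d G x \<le> r\<^sup>2} =
      (\<integral>\<^sup>+ x. indicator {..r\<^sup>2} (quad_form d G x) \<partial>?M)"
  proof -
    have "{x \<in> space ?M. quad_form d G x \<le> r\<^sup>2} \<in> sets ?M"
      by measurable
    then have "emeasure ?M {x \<in> space ?M. quad_form d G x \<le> r\<^sup>2} =
        (\<integral>\<^sup>+ x. indicator {x \<in> space ?M. quad_form d G x \<le> r\<^sup>2} x \<partial>?M)"
      by (rule nn_integral_indicator[symmetric])
    also have "\<dots> = (\<integral>\<^sup>+ x. indicator {..r\<^sup>2} (quad_form d G x) \<partial>?M)"
      by (intro nn_integral_cong) (auto split: split_indicator)
    finally show ?thesis .
  qed
  also have "\<dots> = ennreal (1 / sqrt (Determinant.det (Matrix.mat d d (\<lambda>(i, j). G i j)))) *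
    (\<integral>\<^sup>+ x. indicator {..r\<^sup>2} (\<Sum>i<d. (x i)\<^sup>2) \<partial>?M)"
    by (rule nn_integral_quad_form[OF assms(1)]) auto
  also have "(\<integral>\<^sup>+ x. indicator {..r\<^sup>2} (\<Sum>i<d. (x i)\<^sup>2) \<partial>?M) =
      (\<integral>\<^sup>+ x. indicator ({f. sqrt (\<Sum>i<d. (f i)\<^sup>2) \<le> r} \<inter> space ?M) x \<partial>?M)"
  proof (intro nn_integral_cong)
    fix x assume "x \<in> space ?M"
    then show "indicator {..r\<^sup>2} (\<Sum>i<d. (x i)\<^sup>2) =
        (indicator ({f. sqrt (\<Sum>i<d. (f i)\<^sup>2) \<le> r} \<inter> space ?M) x :: ennreal)"
      using assms(2) sqrt_le_D[of "\<Sum>i<d. (x i)\<^sup>2" r]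
        real_le_lsqrt[of r "\<Sum>i<d. (x i)\<^sup>2"]
      by (simp add: indicator_def) blast
  qed
  also have "\<dots> = emeasure ?M ({f. sqrt (\<Sum>i<d. (f i)\<^sup>2) \<le> r} \<inter> space ?M)"
  proof (rule nn_integral_indicator)
    have "{x \<in> space ?M. sqrt (\<Sum>i<d. (x i)\<^sup>2) \<le> r} \<in> sets ?M"
      by measurable
    then show "{f. sqrt (\<Sum>i<d. (f i)\<^sup>2) \<le> r} \<inter> space ?M \<in> sets ?M"
      by (simp add: Int_def conj_commute)
  qed
  also have "\<dots> = ennreal (unit_ball_vol (real d) * r ^ d)"
    by (subst emeasure_cball_aux) (use assms in auto)
  finally have *: "emeasure ?M {x \<in> space ?M. quad_form d G x \<le> r\<^sup>2} =
      ennreal (1 / sqrt (Determinant.det (Matrix.mat d d (\<lambda>(i, j). G i j)))) *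
      ennreal (unit_ball_vol (real d) * r ^ d)" .
  show ?thesis
    unfolding * using det_pos_def[OF assms(1)] assms(2)
    by (subst ennreal_mult[symmetric]) (auto simp: less_imp_le)
qed

section \<open>Lattice points in translates\<close>

lemma distr_translate_PiM_lborel:
  fixes a :: "nat \<Rightarrow> real"
  assumes "finite I"
  shows "distr (PiM I (\<lambda>_. lborel)) (PiM I (\<lambda>_. lborel)) (\<lambda>x. \<lambda>i\<in>I. x i + a i) = PiM I (\<lambda>_. lborel)"
proof -
  interpret product_sigma_finite "\<lambda>_::nat. lborel :: real measure"
    by standard
  let ?M = "PiM I (\<lambda>_. lborel :: real measure)"
  show ?thesis
  proof (rule PiM_eqI[OF assms])
    fix A :: "nat \<Rightarrow> real set"
    assume "\<And>i. i \<in> I \<Longrightarrow> A i \<in> sets lborel"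
    then have [measurable]: "\<And>i. i \<in> I \<Longrightarrow> A i \<in> sets borel" by simp
    have vimage: "(\<lambda>x. \<lambda>i\<in>I. x i + a i) -` Pi\<^sub>E I A \<inter> space ?M = Pi\<^sub>E I (\<lambda>i. (\<lambda>t. t + a i) -` A i)"
      by (auto simp: space_PiM PiE_iff extensional_def)
    have "emeasure (distr ?M ?M (\<lambda>x. \<lambda>i\<in>I. x i + a i)) (Pi\<^sub>E I A) =
        emeasure ?M (Pi\<^sub>E I (\<lambda>i. (\<lambda>t. t + a i) -` A i))"
      unfolding vimage[symmetric]
      by (rule emeasure_distr) (use assms in \<open>auto intro!: sets_PiM_I_finite\<close>)
    also have "\<dots> = (\<Prod>i\<in>I. emeasure lborel ((\<lambda>t. t + a i) -` A i))"
      using assms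
      by (intro emeasure_PiM) (auto intro!: measurable_sets_borel[where M = borel] borel_measurable_add)
    also have "\<dots> = (\<Prod>i\<in>I. emeasure lborel (A i))"
    proof (intro prod.cong refl)
      fix i assume i: "i \<in> I"
      have "emeasure lborel (A i) = emeasure (distr lborel borel ((+) (a i))) (A i)"
        by (simp add: lborel_distr_plus)
      also have "\<dots> = emeasure lborel ((+) (a i) -` A i \<inter> space lborel)"
        using i by (intro emeasure_distr) auto
      finally show "emeasure lborel ((\<lambda>t. t + a i) -` A i) = emeasure lborel (A i)"
        by (simp add: add.commute vimage_def)
    qed
    finally show "emeasure (distr ?M ?M (\<lambda>x. \<lambda>i\<in>I. x i + a i)) (Pi\<^sub>E I A) =
        (\<Prod>i\<in>I. emeasure lborel (A i))" .
  qed simp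
qed

text \<open>Averaging over \<open>c\<close> in the unit cube: the mean number of grid points of
  \<open>c\<close> + Z^d in \<open>U\<close> is exactly the volume of \<open>U\<close>, so not every
  count can be smaller. An infinite count must be excluded separately; it occurs only on a null set
  because the mean is finite.\<close>

lemma ex_translate_many_integer_points:
  fixes U :: "(nat \<Rightarrow> real) set"
  assumes I: "finite I"
    and U [measurable]: "U \<in> sets (PiM I (\<lambda>_. lborel))"
    and fin: "emeasure (PiM I (\<lambda>_. lborel)) U < \<infinity>"
  shows "\<exists>c. let Z = {z \<in> I \<rightarrow>\<^sub>E (UNIV :: int set). (\<lambda>i\<in>I. c i + real_of_int (z i)) \<in> U} in
    finite Z \<and> emeasure (PiM I (\<lambda>_. lborel)) U \<le> of_nat (card Z)"
proof (rule ccontr)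
  interpret product_sigma_finite "\<lambda>_::nat. lborel :: real measure"
    by standard
  let ?M = "PiM I (\<lambda>_. lborel :: real measure)"
  let ?J = "I \<rightarrow>\<^sub>E (UNIV :: int set)"
  let ?V = "emeasure ?M U"
  define T where "T z x = (\<lambda>i\<in>I. x i + real_of_int (z i))" for z and x :: "nat \<Rightarrow> real"
  define Q where "Q = Pi\<^sub>E I (\<lambda>_. {0..<1::real})"
  define Z where "Z c = {z \<in> ?J. T z c \<in> U}" for c
  define g where "g c = (\<integral>\<^sup>+ z. indicator Q c * indicator U (T z c) \<partial>count_space ?J)" for c
  assume "\<not> (\<exists>c. let Z = {z \<in> ?J. (\<lambda>i\<in>I. c i + real_of_int (z i)) \<in> U} in
    finite Z \<and> ?V \<le> of_nat (card Z))"
  then have few: "finite (Z c) \<Longrightarrow> of_nat (card (Z c)) < ?V" for c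
    by (auto simp: Z_def T_def Let_def not_le)
  have J: "countable ?J"
    using I by (intro countable_PiE) auto
  have [measurable]: "Q \<in> sets ?M"
    unfolding Q_def using I by (intro sets_PiM_I_finite) auto
  have T [measurable]: "T z \<in> measurable ?M ?M" for z
    unfolding T_def by measurable
  have Q1: "emeasure ?M Q = 1"
    unfolding Q_def using I by (subst emeasure_PiM) auto
  interpret M: sigma_finite_measure ?M
    using I by (rule sigma_finite)
  interpret C: sigma_finite_measure "count_space ?J"
    using J by (rule sigma_finite_measure_count_space_countable)
  interpret P: pair_sigma_finite "count_space ?J" ?M ..
  \<comment> \<open>The piece of \<open>U\<close> in the unit cell with corner \<open>z\<close>.
    Translating the cell back by \<open>z\<close> turns it into \<open>Q\<close>, which converts the
    volume of the piece into an integral over \<open>c\<close> in \<open>Q\<close>.\<close>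
  define A where "A z = {x \<in> space ?M. x \<in> U \<and> (\<forall>i\<in>I. \<lfloor>x i\<rfloor> = z i)}" for z
  have A [measurable]: "A z \<in> sets ?M" for z
  proof -
    have "{x \<in> space ?M. \<forall>i\<in>I. \<lfloor>x i\<rfloor> = z i} \<in> sets ?M"
      using I by measurable
    then have "U \<inter> {x \<in> space ?M. \<forall>i\<in>I. \<lfloor>x i\<rfloor> = z i} \<in> sets ?M"
      by simp
    also have "U \<inter> {x \<in> space ?M. \<forall>i\<in>I. \<lfloor>x i\<rfloor> = z i} = A z"
      by (auto simp: A_def)
    finally show ?thesis .
  qed
  have UA: "U = (\<Union>z\<in>?J. A z)"
  proof (intro equalityI subsetI)
    fix x assume x: "x \<in> U"
    then have "x \<in> space ?M" using sets.sets_into_space[OF U] by auto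
    with x have "x \<in> A (\<lambda>i\<in>I. \<lfloor>x i\<rfloor>)" by (auto simp: A_def)
    moreover have "(\<lambda>i\<in>I. \<lfloor>x i\<rfloor>) \<in> ?J" by simp
    ultimately show "x \<in> (\<Union>z\<in>?J. A z)" by (rule UN_I[rotated])
  qed (auto simp: A_def)
  have disj: "disjoint_family_on A ?J"
  proof (unfold disjoint_family_on_def, intro ballI impI)
    fix z w assume "z \<in> ?J" "w \<in> ?J" "z \<noteq> w"
    then obtain i where "i \<in> I" "z i \<noteq> w i"
      by (meson PiE_ext)
    then show "A z \<inter> A w = {}" by (auto simp: A_def)
  qed
  have shift: "emeasure ?M (A z) = (\<integral>\<^sup>+ c. indicator Q c * indicator U (T z c) \<partial>?M)" for z
  proof -
    have "distr ?M ?M (T z) = ?M"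
      unfolding T_def using I by (rule distr_translate_PiM_lborel)
    then have "emeasure ?M (A z) = emeasure (distr ?M ?M (T z)) (A z)"
      by simp
    also have "\<dots> = emeasure ?M (T z -` A z \<inter> space ?M)"
      by (rule emeasure_distr) auto
    also have "\<dots> = (\<integral>\<^sup>+ c. indicator (T z -` A z \<inter> space ?M) c \<partial>?M)"
      by (rule nn_integral_indicator[symmetric]) simp
    also have "\<dots> = (\<integral>\<^sup>+ c. indicator Q c * indicator U (T z c) \<partial>?M)"
    proof (intro nn_integral_cong)
      fix c assume c: "c \<in> space ?M"
      have "T z c \<in> space ?M" using measurable_space[OF T c] .
      moreover have "(\<forall>i\<in>I. \<lfloor>T z c i\<rfloor> = z i) \<longleftrightarrow> c \<in> Q"
        using c by (auto simp: T_def Q_def space_PiM PiE_iff floor_eq_iff)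
      ultimately show "indicator (T z -` A z \<inter> space ?M) c =
          (indicator Q c * indicator U (T z c) :: ennreal)"
        using c by (auto simp: A_def indicator_def)
    qed
    finally show ?thesis .
  qed
  have m: "(\<lambda>(z, c). indicator Q c * indicator U (T z c) :: ennreal) \<in> borel_measurable (count_space ?J \<Otimes>\<^sub>M ?M)"
  proof (rule measurable_pair_measure_countable1[OF J])
    fix z
    have "(\<lambda>c. indicator Q c * indicator U (T z c) :: ennreal) \<in> borel_measurable ?M"
      by measurable
    then show "(\<lambda>c. (case (z, c) of (z, c) \<Rightarrow> indicator Q c * indicator U (T z c)) :: ennreal)
        \<in> borel_measurable ?M"
      by simp
  qed
  have m': "(\<lambda>(c, z). indicator Q c * indicator U (T z c) :: ennreal) \<in> borel_measurable (?M \<Otimes>\<^sub>M count_space ?J)"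
    using m by (subst measurable_pair_swap_iff) (simp add: split_beta')
  have g [measurable]: "g \<in> borel_measurable ?M"
    unfolding g_def using C.borel_measurable_nn_integral[OF m'] by simp
  have "?V = (\<integral>\<^sup>+ z. emeasure ?M (A z) \<partial>count_space ?J)"
    by (subst UA, rule emeasure_UN_countable[OF _ J disj]) simp
  also have "\<dots> = (\<integral>\<^sup>+ z. \<integral>\<^sup>+ c. indicator Q c * indicator U (T z c) \<partial>?M \<partial>count_space ?J)"
    by (simp add: shift)
  also have "\<dots> = (\<integral>\<^sup>+ c. g c \<partial>?M)"
    unfolding g_def using P.Fubini'[OF m] by simp
  finally have intg: "(\<integral>\<^sup>+ c. g c \<partial>?M) = ?V" by simp
  have g_eq: "g c = indicator Q c * emeasure (count_space ?J) (Z c)" for c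
  proof -
    have "g c = (\<integral>\<^sup>+ z. indicator Q c * indicator (Z c) z \<partial>count_space ?J)"
      unfolding g_def Z_def by (intro nn_integral_cong) (auto simp: indicator_def)
    also have "\<dots> = indicator Q c * (\<integral>\<^sup>+ z. indicator (Z c) z \<partial>count_space ?J)"
      by (intro nn_integral_cmult) simp
    also have "(\<integral>\<^sup>+ z. indicator (Z c) z \<partial>count_space ?J) = emeasure (count_space ?J) (Z c)"
      by (intro nn_integral_indicator) (auto simp: Z_def)
    finally show ?thesis .
  qed
  have "AE c in ?M. g c \<noteq> \<infinity>"
    using fin intg by (intro nn_integral_PInf_AE) auto
  \<comment> \<open>On the cube the count is almost everywhere strictly below its own mean. The
    difference \<open>?V * indicator Q c - g c\<close> then has integral 0 although it is positive
    almost everywhere on \<open>Q\<close>, which forces the cube to be null.\<close>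
  then have less: "AE c in ?M. c \<in> Q \<longrightarrow> g c < ?V"
  proof (rule AE_mp, intro AE_I2 impI)
    fix c assume c: "c \<in> Q" "g c \<noteq> \<infinity>"
    have "Z c \<subseteq> ?J" by (auto simp: Z_def)
    with c have "finite (Z c)" "g c = of_nat (card (Z c))"
      by (auto simp: g_eq emeasure_count_space split: if_splits)
    then show "g c < ?V" using few by simp
  qed
  have "(\<integral>\<^sup>+ c. (?V * indicator Q c - g c) \<partial>?M) = (\<integral>\<^sup>+ c. ?V * indicator Q c \<partial>?M) - (\<integral>\<^sup>+ c. g c \<partial>?M)"
  proof (rule nn_integral_diff)
    show "AE c in ?M. g c \<le> ?V * indicator Q c"
      using less by eventually_elim (auto simp: indicator_def g_eq)
  qed (use fin intg in auto)
  also have "(\<integral>\<^sup>+ c. ?V * indicator Q c \<partial>?M) = ?V"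
    by (subst nn_integral_cmult) (auto simp: Q1)
  finally have "(\<integral>\<^sup>+ c. (?V * indicator Q c - g c) \<partial>?M) = 0"
    using intg fin by simp
  then have "AE c in ?M. ?V * indicator Q c - g c = 0"
    by (subst (asm) nn_integral_0_iff_AE) auto
  with less have "AE c in ?M. c \<notin> Q"
  proof eventually_elim
    case (elim c)
    then show ?case
      using ennreal_minus_eq_0[of ?V "g c"] by auto
  qed
  then have "emeasure ?M {c \<in> space ?M. c \<in> Q} = 0"
    by (subst (asm) AE_iff_measurable[OF _ refl]) auto
  moreover have "{c \<in> space ?M. c \<in> Q} = Q"
    by (auto simp: Q_def space_PiM PiE_iff extensional_def)
  ultimately show False using Q1 by simp
qed

section \<open>Determinant inequalities for Gram matrices\<close>

definition gram :: "complex^'n::finite^'r::finite \<Rightarrow> complex^'n^'n" where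
  "gram A = conj_transpose A ** A"

lemma gram_nth: "gram A $ i $ j = (\<Sum>k\<in>UNIV. cnj (A $ k $ i) * A $ k $ j)"
  by (simp add: gram_def conj_transpose_def matrix_matrix_mult_def map_matrix_def
      Finite_Cartesian_Product.transpose_def)

lemma conj_transpose_mult:
  "conj_transpose (A ** B) = conj_transpose B ** conj_transpose (A :: complex^'n::finite^'r::finite)"
  by (simp add: conj_transpose_def matrix_matrix_mult_def map_matrix_def
      Finite_Cartesian_Product.transpose_def Finite_Cartesian_Product.vec_eq_iff mult.commute)

lemma gram_mult: "gram (A ** U) = conj_transpose U ** gram A ** U"
  by (simp add: gram_def conj_transpose_mult matrix_mul_assoc)

lemma det_conj_transpose: "det (conj_transpose U) = cnj (det U)"
proof -
  have "conj_transpose U = Finite_Cartesian_Product.transpose (map_matrix cnj U)"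
    by (simp add: conj_transpose_def map_matrix_def Finite_Cartesian_Product.transpose_def)
  then have "det (conj_transpose U) = det (map_matrix cnj U)"
    by (simp add: Determinants.det_transpose)
  then show ?thesis
    by (simp add: Determinants.det_def map_matrix_def)
qed

text \<open>Used in two ways: with \<open>det U = 1\<close> for column operations, and with
  \<open>U\<close> a block of a lattice point, where it separates the fading from the
  codeword.\<close>

lemma det_gram_mult:
  "det (gram (A ** U)) =
    of_real ((cmod (det U))\<^sup>2) * det (gram A)"
  unfolding gram_mult Determinants.det_mul det_conj_transpose complex_norm_square
  by (simp add: mult_ac)

lemma gram_diag: "gram A $ j $ j = of_real (\<Sum>k\<in>UNIV. (cmod (A $ k $ j))\<^sup>2)"
  by (simp add: gram_nth complex_norm_square mult.commute del: of_real_power)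

lemma gram_adjoint: "gram A $ i $ j = cnj (gram A $ j $ i)"
  by (simp add: gram_nth mult.commute)

lemma norm_matrix_square:
  "(norm (A :: complex^'n::finite^'r::finite))\<^sup>2 = (\<Sum>j\<in>UNIV. \<Sum>k\<in>UNIV. (cmod (A $ k $ j))\<^sup>2)"
  by (simp add: norm_vec_def L2_set_def sum_nonneg) (rule sum.swap)

text \<open>Transposed, this is the identity with a combination of other rows added to row
  \<open>j\<close>, an operation that preserves the determinant. Right multiplication by it adds a
  combination of the columns in \<open>S\<close> to column \<open>j\<close>.\<close>

lemma det_column_transvection:
  fixes c :: "'n::finite \<Rightarrow> complex"
  assumes "j \<notin> S"
  shows "det (\<chi> k l. if l = j \<and> k \<in> S then c k else if k = l then 1 else 0) = 1"
proof -
  let ?I = "mat 1 :: complex^'n^'n"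
  let ?x = "\<Sum>s\<in>S. c s *s row s ?I"
  have "?x \<in> vec.span {row i ?I |i. i \<noteq> j}"
    using assms by (intro vec.span_sum vec.span_scale vec.span_base) auto
  from Determinants.det_row_span[OF this]
  have "det (\<chi> k. if k = j then row j ?I + ?x else row k ?I) = 1"
    by simp
  moreover have x: "(\<Sum>s\<in>S. c s * (if s = l then 1 else 0)) = (if l \<in> S then c l else 0)" for l
    by (simp add: if_distrib cong: if_cong)
  have "(\<chi> k. if k = j then row j ?I + ?x else row k ?I) =
      Finite_Cartesian_Product.transpose
        (\<chi> k l. if l = j \<and> k \<in> S then c k else if k = l then 1 else 0)"
    by (simp only: Finite_Cartesian_Product.vec_eq_iff)
      (use assms in \<open>auto simp: Finite_Cartesian_Product.transpose_def x
        Finite_Cartesian_Product.row_def Finite_Cartesian_Product.mat_def\<close>)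
  ultimately show ?thesis
    by (simp only: Determinants.det_transpose)
qed

text \<open>Gram-Schmidt without normalisation: each column loses its projection on the columns
  treated before. Such steps have determinant 1 and, by Pythagoras, cannot lengthen a
  column.\<close>

lemma gram_schmidt_columns:
  fixes A :: "complex^'n::finite^'r::finite"
  assumes "finite S"
  shows "\<exists>U. det U = 1 \<and> (\<forall>i\<in>S. \<forall>j\<in>S. i \<noteq> j \<longrightarrow> gram (A ** U) $ i $ j = 0) \<and>
    (\<forall>j. Re (gram (A ** U) $ j $ j) \<le> Re (gram A $ j $ j))"
  using assms
proof (induction S)
  case empty
  have "A ** mat 1 = A" by (rule matrix_mul_rid)
  then show ?case
    by (intro exI[of _ "mat 1"]) simp
next
  case (insert j S)
  then obtain U where U: "det U = 1"
    and orth: "\<And>s t. s \<in> S \<Longrightarrow> t \<in> S \<Longrightarrow> s \<noteq> t \<Longrightarrow> gram (A ** U) $ s $ t = 0"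
    and small: "\<And>i. Re (gram (A ** U) $ i $ i) \<le> Re (gram A $ i $ i)"
    by blast
  define B where "B = A ** U"
  \<comment> \<open>Minus the coefficient of the projection of column \<open>j\<close> on column
    \<open>s\<close>; 0 by the convention on division if column \<open>s\<close> vanishes.\<close>
  define c where "c s = - gram B $ s $ j / gram B $ s $ s" for s
  define E :: "complex^'n^'n" where
    "E = (\<chi> k l. if l = j \<and> k \<in> S then c k else if k = l then 1 else 0)"
  define p where "p k = (\<Sum>s\<in>S. B $ k $ s * c s)" for k
  have other: "(B ** E) $ k $ l = B $ k $ l" if "l \<noteq> j" for k l
    using that by (simp add: E_def matrix_matrix_mult_def if_distrib cong: if_cong)
  have new: "(B ** E) $ k $ j = B $ k $ j + p k" for k
  proof -
    have "(B ** E) $ k $ j = (\<Sum>m\<in>UNIV. (if m = j then B $ k $ j else 0) + (if m \<in> S then B $ k $ m * c m else 0))"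
      unfolding matrix_matrix_mult_def E_def using insert.hyps by (auto intro!: sum.cong)
    then show ?thesis
      by (simp add: sum.distrib p_def sum.If_cases)
  qed
  have orth_new: "gram (B ** E) $ s $ j = 0" if s: "s \<in> S" for s
  proof -
    have "gram (B ** E) $ s $ j = (\<Sum>k\<in>UNIV. cnj (B $ k $ s) * (B $ k $ j + p k))"
      using s insert.hyps by (subst gram_nth) (metis new other)
    also have "\<dots> = gram B $ s $ j + (\<Sum>k\<in>UNIV. \<Sum>t\<in>S. cnj (B $ k $ s) * B $ k $ t * c t)"
      by (simp add: gram_nth p_def ring_distribs sum.distrib sum_distrib_left mult.assoc)
    also have "(\<Sum>k\<in>UNIV. \<Sum>t\<in>S. cnj (B $ k $ s) * B $ k $ t * c t) = (\<Sum>t\<in>S. gram B $ s $ t * c t)"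
      by (subst sum.swap) (simp add: gram_nth sum_distrib_right)
    also have "\<dots> = (\<Sum>t\<in>S. if t = s then gram B $ s $ s * c s else 0)"
      using orth s by (intro sum.cong) (auto simp: B_def)
    also have "\<dots> = gram B $ s $ s * c s"
      using s insert.hyps by simp
    finally have eq: "gram (B ** E) $ s $ j = gram B $ s $ j + gram B $ s $ s * c s" .
    show ?thesis
    \<comment> \<open>A column of norm 0 is zero, hence orthogonal to everything, whatever
      \<open>c s\<close> is.\<close>
    proof (cases "gram B $ s $ s = 0")
      case True
      then have "(\<Sum>k\<in>UNIV. (cmod (B $ k $ s))\<^sup>2) = 0"
        unfolding gram_diag by (simp only: of_real_eq_0_iff)
      then have "B $ k $ s = 0" for k
        by (subst (asm) sum_nonneg_eq_0_iff) auto
      then have "gram B $ s $ j = 0" by (simp add: gram_nth)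
      with True eq show ?thesis by simp
    qed (use eq in \<open>simp add: c_def\<close>)
  qed
  \<comment> \<open>The columns in \<open>S\<close> are untouched by \<open>E\<close>, so the
    correction \<open>p\<close> is a combination of columns already orthogonal to the new column
    \<open>j\<close>.\<close>
  have p_new: "p k = (\<Sum>s\<in>S. (B ** E) $ k $ s * c s)" for k
    unfolding p_def using insert.hyps by (intro sum.cong refl) (metis other)
  have "(\<Sum>k\<in>UNIV. cnj (p k) * (B ** E) $ k $ j) =
      (\<Sum>k\<in>UNIV. \<Sum>s\<in>S. cnj (c s) * (cnj ((B ** E) $ k $ s) * (B ** E) $ k $ j))"
    by (intro sum.cong refl) (simp add: p_new sum_distrib_right sum_distrib_left mult_ac)
  also have "\<dots> = (\<Sum>s\<in>S. cnj (c s) * gram (B ** E) $ s $ j)"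
    by (subst sum.swap) (simp add: gram_nth sum_distrib_left)
  also have "\<dots> = 0"
    by (simp add: orth_new)
  finally have p_orth: "(\<Sum>k\<in>UNIV. cnj (p k) * (B ** E) $ k $ j) = 0" .
  have "Re (gram (B ** E) $ j $ j) \<le> Re (gram B $ j $ j)"
  proof -
    \<comment> \<open>The old column is the new one minus \<open>p\<close>; the cross term
      disappears after summation by \<open>p_orth\<close>.\<close>
    have pyth: "(cmod (B $ k $ j))\<^sup>2 = (cmod ((B ** E) $ k $ j))\<^sup>2 + (cmod (p k))\<^sup>2
        - 2 * Re (cnj (p k) * (B ** E) $ k $ j)" for k
      unfolding new cmod_power2 by (simp add: power2_eq_square algebra_simps)
    have "(\<Sum>k\<in>UNIV. Re (cnj (p k) * (B ** E) $ k $ j)) = 0"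
      unfolding Re_sum[symmetric] p_orth by simp
    then have "(\<Sum>k\<in>UNIV. (cmod (B $ k $ j))\<^sup>2) =
        (\<Sum>k\<in>UNIV. (cmod ((B ** E) $ k $ j))\<^sup>2) + (\<Sum>k\<in>UNIV. (cmod (p k))\<^sup>2)"
      unfolding pyth sum_subtractf sum.distrib sum_distrib_left[symmetric] by simp
    then show ?thesis
      by (simp add: gram_diag sum_nonneg)
  qed
  moreover have same: "gram (B ** E) $ i $ l = gram B $ i $ l" if "i \<noteq> j" "l \<noteq> j" for i l
    using that by (simp add: gram_nth other)
  ultimately have "Re (gram (B ** E) $ i $ i) \<le> Re (gram A $ i $ i)" for i
    using small[of i] by (cases "i = j") (auto simp: B_def)
  moreover have "gram (B ** E) $ i $ l = 0" if il: "i \<in> insert j S" "l \<in> insert j S" "i \<noteq> l" for i l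
  proof -
    note il = that
    consider "i = j" "l \<in> S" | "l = j" "i \<in> S" | "i \<in> S" "l \<in> S" "i \<noteq> j" "l \<noteq> j"
      using il by auto
    then show ?thesis
    proof cases
      case 1
      then show ?thesis using orth_new[of l] gram_adjoint[of "B ** E" j l] by simp
    next
      case 3
      then show ?thesis using orth[of i l] il same by (simp flip: B_def)
    qed (simp add: orth_new)
  qed
  moreover have "det (U ** E) = 1"
    unfolding Determinants.det_mul U E_def
    using det_column_transvection[OF insert.hyps(2), of c] by simp
  moreover have "B ** E = A ** (U ** E)"
    by (simp add: B_def matrix_mul_assoc)
  ultimately show ?case
    by metis
qed

text \<open>The numbers \<open>\<beta> j\<close> are the squared column lengths after
  orthogonalisation. Keeping them explicit gives the product for the determinant and the sum for the
  Frobenius norm together, which is the input of AM-GM, and it shows that the determinant is real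
  and nonnegative.\<close>

lemma hadamard_gram:
  fixes A :: "complex^'n::finite^'r::finite"
  obtains \<beta> :: "'n \<Rightarrow> real" where "\<And>j. 0 \<le> \<beta> j" and "det (gram A) = of_real (\<Prod>j\<in>UNIV. \<beta> j)"
    and "(\<Sum>j\<in>UNIV. \<beta> j) \<le> (norm A)\<^sup>2"
proof -
  obtain U :: "complex^'n^'n" where U: "det U = 1"
    and orth: "\<And>s t. s \<noteq> t \<Longrightarrow> gram (A ** U) $ s $ t = 0"
    and small: "\<And>i. Re (gram (A ** U) $ i $ i) \<le> Re (gram A $ i $ i)"
    using gram_schmidt_columns[of "UNIV :: 'n set" A] by auto
  define \<beta> where "\<beta> j = (\<Sum>k\<in>UNIV. (cmod ((A ** U) $ k $ j))\<^sup>2)" for j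
  have "det (gram A) = det (gram (A ** U))"
    by (simp add: det_gram_mult U)
  also have "\<dots> = (\<Prod>j\<in>UNIV. gram (A ** U) $ j $ j)"
    by (rule Determinants.det_diagonal) (rule orth)
  also have "\<dots> = of_real (\<Prod>j\<in>UNIV. \<beta> j)"
  proof -
    have "gram (A ** U) $ j $ j = of_real (\<beta> j)" for j
      by (simp only: gram_diag \<beta>_def)
    then show ?thesis by simp
  qed
  finally have 1: "det (gram A) = of_real (\<Prod>j\<in>UNIV. \<beta> j)" .
  have 2: "(\<Sum>j\<in>UNIV. \<beta> j) \<le> (norm A)\<^sup>2"
    unfolding norm_matrix_square \<beta>_def by (rule sum_mono) (use small in \<open>simp add: gram_diag\<close>)
  have "0 \<le> \<beta> j" for j
    by (simp add: \<beta>_def sum_nonneg)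
  then show ?thesis by (rule that[OF _ 1 2])
qed

lemma det_gram_nonneg: "0 \<le> Re (det (gram A))"
  using hadamard_gram[of A] by (metis Re_complex_of_real prod_nonneg)

lemma det_gram_real: "det (gram A) = of_real (Re (det (gram A)))"
  using hadamard_gram[of A] by (metis Re_complex_of_real)

text \<open>AM-GM in the form x <= exp (x - 1) applied to each \<open>\<beta> j / T\<close>. With a
  common scale \<open>T\<close> these bounds multiply over the blocks and no roots have to be
  taken.\<close>

lemma det_gram_le_exp:
  fixes A :: "complex^'n::finite^'r::finite"
  assumes "T > 0"
  shows "Re (det (gram A)) / T ^ CARD('n) \<le> exp ((norm A)\<^sup>2 / T - real CARD('n))"
proof -
  obtain \<beta> :: "'n \<Rightarrow> real" where \<beta>: "\<And>j. 0 \<le> \<beta> j"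
    "det (gram A) = of_real (\<Prod>j\<in>UNIV. \<beta> j)"
    "(\<Sum>j\<in>UNIV. \<beta> j) \<le> (norm A)\<^sup>2"
    using hadamard_gram[of A] by blast
  have "Re (det (gram A)) / T ^ CARD('n) = (\<Prod>j\<in>UNIV. \<beta> j / T)"
    unfolding \<beta>(2) Re_complex_of_real by (simp add: prod_dividef)
  also have "\<dots> \<le> (\<Prod>j\<in>UNIV. exp (\<beta> j / T - 1))"
    using assms \<beta>(1) by (intro prod_mono conjI) (auto, metis add.commute diff_add_cancel exp_ge_add_one_self)
  also have "\<dots> = exp ((\<Sum>j\<in>UNIV. \<beta> j) / T - real CARD('n))"
    by (simp add: exp_sum[symmetric] sum_subtractf sum_divide_distrib)
  also have "\<dots> \<le> exp ((norm A)\<^sup>2 / T - real CARD('n))"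
    using \<beta>(3) assms by (simp add: divide_right_mono)
  finally show ?thesis .
qed

text \<open>\<open>T\<close> is a lower bound for the nk-th root of the product of the fading
  determinants. Multiplying the exponential bounds over all blocks gives 1 <= exp (sum / T - nk),
  and the exponent must be nonnegative.\<close>

lemma norm_sum_mult_ge:
  fixes h :: "nat \<Rightarrow> complex^'n::finite^'r::finite" and l :: "'n blocks"
  assumes "T > 0" and "1 \<le> cmod (pdet k l)"
    and "T ^ (CARD('n) * k) \<le> (\<Prod>i=1..k. Re (det (gram (h i))))"
  shows "real CARD('n) * real k * T \<le> (\<Sum>i=1..k. (norm (h i ** l i))\<^sup>2)"
proof -
  let ?n = "CARD('n)"
  have mult: "Re (det (gram (h i ** l i))) =
      (cmod (det (l i)))\<^sup>2 * Re (det (gram (h i)))" for i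
    unfolding det_gram_mult by (metis Re_complex_of_real det_gram_real of_real_mult)
  have "T ^ (?n * k) \<le> (cmod (pdet k l))\<^sup>2 * (\<Prod>i=1..k. Re (det (gram (h i))))"
    using assms one_le_power[OF assms(2), of 2]
    by (smt (verit) mult_le_cancel_right1 zero_less_power)
  also have "\<dots> = (\<Prod>i=1..k. Re (det (gram (h i ** l i))))"
    unfolding mult pdet_def prod.distrib by (simp add: prod_norm[symmetric] prod_power_distrib)
  finally have "1 \<le> (\<Prod>i=1..k. Re (det (gram (h i ** l i)))) / T ^ (?n * k)"
    using assms(1) by simp
  also have "\<dots> = (\<Prod>i=1..k. Re (det (gram (h i ** l i))) / T ^ ?n)"
    by (simp add: prod_dividef power_mult)
  also have "\<dots> \<le> (\<Prod>i=1..k. exp ((norm (h i ** l i))\<^sup>2 / T - real ?n))"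
    using assms(1) by (intro prod_mono conjI det_gram_le_exp) (auto simp: det_gram_nonneg)
  also have "\<dots> = exp ((\<Sum>i=1..k. (norm (h i ** l i))\<^sup>2) / T - real ?n * real k)"
    by (simp add: exp_sum[symmetric] sum_subtractf sum_divide_distrib)
  finally have "real ?n * real k \<le> (\<Sum>i=1..k. (norm (h i ** l i))\<^sup>2) / T"
    by simp
  then show ?thesis
    using assms(1) by (simp add: pos_le_divide_eq)
qed

text \<open>If the Gram matrix kills x, then h x has squared norm 0, and a left inverse of
  \<open>h\<close> gives x = 0.\<close>

lemma det_gram_pos:
  fixes h :: "complex^'n::finite^'r::finite"
  assumes "rank h = CARD('n)"
  shows "0 < Re (det (gram h))"
proof -
  \<comment> \<open>Here rank is row rank: full rank means that the rows span, which is equivalent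
    to having a left inverse.\<close>
  have "vec.span (rows h) = UNIV"
    using assms unfolding row_rank_def_gen
    by (simp add: vec.dim_eq_full[symmetric] vec.dimension_def card_cart_basis)
  then obtain B :: "complex^'r^'n" where B: "B ** h = mat 1"
    using matrix_left_invertible_span_rows_gen[of h] by blast
  have "x = 0" if x: "gram h *v x = 0" for x :: "complex^'n"
  proof -
    have "(\<Sum>i\<in>UNIV. cnj (x $ i) * (gram h *v x) $ i) =
        (\<Sum>i\<in>UNIV. \<Sum>j\<in>UNIV. \<Sum>k\<in>UNIV. cnj (x $ i) * (cnj (h $ k $ i) * h $ k $ j * x $ j))"
      by (simp add: matrix_vector_mult_def gram_nth sum_distrib_left sum_distrib_right)
    also have "\<dots> = (\<Sum>i\<in>UNIV. \<Sum>k\<in>UNIV. \<Sum>j\<in>UNIV. cnj (x $ i) * (cnj (h $ k $ i) * h $ k $ j * x $ j))"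
      by (intro sum.cong refl sum.swap)
    also have "\<dots> = (\<Sum>k\<in>UNIV. \<Sum>i\<in>UNIV. \<Sum>j\<in>UNIV. cnj (x $ i) * (cnj (h $ k $ i) * h $ k $ j * x $ j))"
      by (rule sum.swap)
    also have "\<dots> = (\<Sum>k\<in>UNIV. cnj ((h *v x) $ k) * (h *v x) $ k)"
      by (intro sum.cong refl, simp add: matrix_vector_mult_def sum_product,
          intro sum.cong refl, simp add: mult_ac)
    also have "\<dots> = of_real (\<Sum>k\<in>UNIV. (cmod ((h *v x) $ k))\<^sup>2)"
      by (simp add: complex_norm_square mult.commute del: of_real_power)
    finally have "complex_of_real (\<Sum>k\<in>UNIV. (cmod ((h *v x) $ k))\<^sup>2) = 0"
      unfolding x by simp
    then have "(\<Sum>k\<in>UNIV. (cmod ((h *v x) $ k))\<^sup>2) = 0"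
      by (simp only: of_real_eq_0_iff)
    then have "h *v x = 0"
      by (subst (asm) sum_nonneg_eq_0_iff) (auto simp: Finite_Cartesian_Product.vec_eq_iff)
    then have "(B ** h) *v x = 0"
      by (simp add: matrix_vector_mul_assoc[symmetric])
    then show "x = 0" unfolding B by simp
  qed
  then have "\<exists>C. C ** gram h = mat 1"
    by (subst matrix_left_invertible_ker) blast
  then have "invertible (gram h)"
    using matrix_left_right_inverse unfolding invertible_def by blast
  then have "det (gram h) \<noteq> 0"
    by (simp add: invertible_det_nz)
  then have "Re (det (gram h)) \<noteq> 0"
    by (metis det_gram_real of_real_0)
  then show ?thesis
    using det_gram_nonneg[of h] by simp
qed

section \<open>Concentration of the projected noise\<close>

lemma (in prob_space) integrable_of_square:
  fixes X :: "'a \<Rightarrow> real"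
  assumes [measurable]: "X \<in> borel_measurable M" and "integrable M (\<lambda>x. (X x)\<^sup>2)"
  shows "integrable M X"
proof (rule Bochner_Integration.integrable_bound)
  show "integrable M (\<lambda>x. 1 + (X x)\<^sup>2)"
    using assms by simp
  have "\<bar>t\<bar> \<le> 1 + t\<^sup>2" for t :: real
    using self_le_power[of "\<bar>t\<bar>" 2] by (cases "1 \<le> \<bar>t\<bar>") (auto simp: add_increasing2)
  then show "AE x in M. norm (X x) \<le> norm (1 + (X x)\<^sup>2)"
    by (auto simp: abs_of_nonneg)
qed simp

text \<open>After centring, the mixed terms of the squared sum have mean 0 by independence.\<close>

lemma (in prob_space) variance_sum_indep_vars:
  fixes X :: "'i \<Rightarrow> 'a \<Rightarrow> real"
  assumes I: "finite I" and indep: "indep_vars (\<lambda>_. borel) X I"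
    and sq: "\<And>i. i \<in> I \<Longrightarrow> integrable M (\<lambda>x. (X i x)\<^sup>2)"
  shows "integrable M (\<lambda>x. (\<Sum>i\<in>I. X i x)\<^sup>2)"
    and "variance (\<lambda>x. \<Sum>i\<in>I. X i x) = (\<Sum>i\<in>I. variance (X i))"
proof -
  define m where "m i = expectation (X i)" for i
  define Y where "Y i x = X i x - m i" for i x
  have X [measurable]: "X i \<in> borel_measurable M" if "i \<in> I" for i
    using indep that by (auto simp: indep_vars_def)
  have int: "integrable M (X i)" if "i \<in> I" for i
    by (rule integrable_of_square[OF X[OF that] sq[OF that]])
  have intY: "integrable M (Y i)" if "i \<in> I" for i
    unfolding Y_def using int[OF that] by auto
  have EY: "expectation (Y i) = 0" if "i \<in> I" for i
    unfolding Y_def using int[OF that] by (simp add: m_def prob_space)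
  have indepY: "indep_vars (\<lambda>_. borel) Y I"
    unfolding Y_def by (rule indep_vars_compose2[OF indep]) simp
  have pair: "integrable M (\<lambda>x. Y i x * Y j x)" "expectation (\<lambda>x. Y i x * Y j x) = 0"
    if "i \<in> I" "j \<in> I" "i \<noteq> j" for i j
  proof -
    have ind: "indep_vars (\<lambda>_. borel) Y {i, j}"
      using that by (intro indep_vars_subset[OF indepY]) auto
    show "integrable M (\<lambda>x. Y i x * Y j x)"
      using indep_vars_integrable[OF _ ind] that intY by auto
    show "expectation (\<lambda>x. Y i x * Y j x) = 0"
      using indep_vars_lebesgue_integral[OF _ ind] that intY EY by auto
  qed
  have sqY: "integrable M (\<lambda>x. Y i x * Y i x)" if "i \<in> I" for i
  proof -
    have "integrable M (\<lambda>x. (X i x)\<^sup>2 - 2 * m i * X i x + (m i)\<^sup>2)"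
      using sq[OF that] int[OF that] by auto
    then show ?thesis
      by (simp add: Y_def power2_eq_square algebra_simps)
  qed
  have all: "integrable M (\<lambda>x. Y i x * Y j x)" if "i \<in> I" "j \<in> I" for i j
    using pair(1) sqY that by (cases "i = j") auto
  have S2: "(\<Sum>i\<in>I. Y i x)\<^sup>2 = (\<Sum>i\<in>I. \<Sum>j\<in>I. Y i x * Y j x)" for x
    by (simp add: power2_eq_square sum_product)
  have intS2: "integrable M (\<lambda>x. (\<Sum>i\<in>I. Y i x)\<^sup>2)"
    unfolding S2 using all by auto
  have E: "expectation (\<lambda>x. \<Sum>i\<in>I. X i x) = (\<Sum>i\<in>I. m i)"
    using int by (simp add: m_def)
  have X_Y: "(\<Sum>i\<in>I. X i x) = (\<Sum>i\<in>I. Y i x) + (\<Sum>i\<in>I. m i)" for x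
    by (simp add: Y_def sum_subtractf)
  have intY': "integrable M (\<lambda>x. \<Sum>i\<in>I. Y i x)"
    using intY by auto
  have "integrable M (\<lambda>x. (\<Sum>i\<in>I. Y i x)\<^sup>2 + 2 * (\<Sum>i\<in>I. m i) * (\<Sum>i\<in>I. Y i x) + (\<Sum>i\<in>I. m i)\<^sup>2)"
    by (intro Bochner_Integration.integrable_add intS2 integrable_mult_right intY') auto
  then show "integrable M (\<lambda>x. (\<Sum>i\<in>I. X i x)\<^sup>2)"
    unfolding X_Y power2_sum by (simp add: algebra_simps)
  have "variance (\<lambda>x. \<Sum>i\<in>I. X i x) = expectation (\<lambda>x. (\<Sum>i\<in>I. Y i x)\<^sup>2)"
  proof -
    have "(\<Sum>i\<in>I. X i x) - expectation (\<lambda>x. \<Sum>i\<in>I. X i x) = (\<Sum>i\<in>I. Y i x)" for x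
      unfolding E by (simp add: X_Y)
    then show ?thesis by (simp only:)
  qed
  also have "\<dots> = (\<Sum>i\<in>I. \<Sum>j\<in>I. expectation (\<lambda>x. Y i x * Y j x))"
    unfolding S2 using all by (simp add: Bochner_Integration.integral_sum)
  also have "\<dots> = (\<Sum>i\<in>I. \<Sum>j\<in>I. if j = i then expectation (\<lambda>x. Y i x * Y i x) else 0)"
    by (intro sum.cong refl) (auto simp: pair)
  also have "\<dots> = (\<Sum>i\<in>I. variance (X i))"
    using I by (simp add: Y_def m_def power2_eq_square)
  finally show "variance (\<lambda>x. \<Sum>i\<in>I. X i x) = (\<Sum>i\<in>I. variance (X i))" .
qed

text \<open>Chebyshev, with the variance bounded by the second moment. Only bounds common to all
  terms enter, so the estimate sees the variables through \<open>card I\<close>, \<open>a\<close>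
  and \<open>c\<close> alone; this yields uniformity in the fading.\<close>

lemma (in prob_space) sum_indep_vars_upper_tail:
  fixes X :: "'i \<Rightarrow> 'a \<Rightarrow> real"
  assumes I: "finite I" and indep: "indep_vars (\<lambda>_. borel) X I"
    and sq: "\<And>i. i \<in> I \<Longrightarrow> integrable M (\<lambda>x. (X i x)\<^sup>2)"
    and a: "\<And>i. i \<in> I \<Longrightarrow> expectation (X i) \<le> a"
    and c: "\<And>i. i \<in> I \<Longrightarrow> expectation (\<lambda>x. (X i x)\<^sup>2) \<le> c"
    and t: "0 < t"
  shows "prob {x \<in> space M. real (card I) * a + t \<le> (\<Sum>i\<in>I. X i x)} \<le> real (card I) * c / t\<^sup>2"
proof -
  have X [measurable]: "X i \<in> borel_measurable M" if "i \<in> I" for i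
    using indep that by (auto simp: indep_vars_def)
  have int: "integrable M (X i)" if "i \<in> I" for i
    by (rule integrable_of_square[OF X[OF that] sq[OF that]])
  let ?S = "\<lambda>x. \<Sum>i\<in>I. X i x"
  have "expectation ?S = (\<Sum>i\<in>I. expectation (X i))"
    using int by simp
  also have "\<dots> \<le> real (card I) * a"
    using sum_bounded_above[of I "\<lambda>i. expectation (X i)" a] a by simp
  finally have E: "expectation ?S \<le> real (card I) * a" .
  have "prob {x \<in> space M. real (card I) * a + t \<le> ?S x} \<le>
      prob {x \<in> space M. t \<le> \<bar>?S x - expectation ?S\<bar>}"
    using E by (intro finite_measure_mono) auto
  also have "\<dots> \<le> variance ?S / t\<^sup>2"
    using variance_sum_indep_vars(1)[OF I indep sq] t by (intro Chebyshev_inequality) auto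
  also have "variance ?S = (\<Sum>i\<in>I. variance (X i))"
    by (rule variance_sum_indep_vars(2)[OF I indep sq])
  also have "\<dots> \<le> (\<Sum>i\<in>I. c)"
  proof (rule sum_mono)
    fix i assume i: "i \<in> I"
    then show "variance (X i) \<le> c"
      using variance_eq[OF int[OF i] sq[OF i]] c[OF i] by (smt (verit) zero_le_power2)
  qed
  also have "\<dots> = real (card I) * c" by simp
  finally show ?thesis
    by (simp add: divide_right_mono)
qed

text \<open>The joint law of the coordinates is the product measure itself, hence the product of the
  marginals.\<close>

lemma indep_vars_PiM_coordinates:
  assumes "I \<noteq> {}" and "\<And>i. i \<in> I \<Longrightarrow> prob_space (N i)"
  shows "prob_space.indep_vars (PiM I N) N (\<lambda>i w. w i) I"
proof -
  interpret prob_space "PiM I N"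
    using assms(2) by (rule prob_space_PiM)
  have "distr (PiM I N) (PiM I N) (\<lambda>w. \<lambda>i\<in>I. w i) = distr (PiM I N) (PiM I N) (\<lambda>w. w)"
    by (intro distr_cong refl) (auto simp: space_PiM PiE_iff extensional_def fun_eq_iff)
  also have "\<dots> = PiM I N" by (rule distr_id)
  also have "\<dots> = (\<Pi>\<^sub>M i\<in>I. distr (PiM I N) (N i) (\<lambda>w. w i))"
    using assms(2) by (intro PiM_cong refl) (simp add: distr_PiM_component)
  finally show ?thesis
    using assms(1) by (subst indep_vars_iff_distr_eq_PiM') auto
qed

section \<open>Moments of a complex Gaussian entry\<close>

abbreviation half_gaussian :: "real measure" where
  "half_gaussian \<equiv> density lborel (normal_density 0 (sqrt (1/2)))"

lemma prob_space_half_gaussian: "prob_space half_gaussian"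
  by (rule prob_space_normal_density) simp

lemma half_gaussian_moments:
  "integrable half_gaussian (\<lambda>x. x ^ m)"
  "integral\<^sup>L half_gaussian (\<lambda>x. x) = 0"
  "integral\<^sup>L half_gaussian (\<lambda>x. x\<^sup>2) = 1 / 2"
proof -
  show "integrable half_gaussian (\<lambda>x. x ^ m)"
    using integrable_normal_moment[of "sqrt (1/2)" 0 m]
    by (subst integrable_density) auto
  show "integral\<^sup>L half_gaussian (\<lambda>x. x) = 0"
    using integral_normal_moment_odd[of "sqrt (1/2)" 0 0]
    by (subst integral_density) auto
  show "integral\<^sup>L half_gaussian (\<lambda>x. x\<^sup>2) = 1 / 2"
    using integral_normal_moment_even[of "sqrt (1/2)" 0 1]
    by (subst integral_density) (auto simp: fact_numeral)
qed

text \<open>Fubini on the real and imaginary parts; every moment used later is a sum of such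
  products.\<close>

lemma complex_gaussian_product:
  assumes f: "integrable half_gaussian f" and g: "integrable half_gaussian g"
  shows "integrable complex_gaussian (\<lambda>z. f (Re z) * g (Im z) :: real)"
    and "integral\<^sup>L complex_gaussian (\<lambda>z. f (Re z) * g (Im z)) =
      integral\<^sup>L half_gaussian f * integral\<^sup>L half_gaussian g"
proof -
  interpret H: prob_space half_gaussian by (rule prob_space_half_gaussian)
  interpret P: pair_prob_space half_gaussian half_gaussian ..
  have [measurable]: "f \<in> borel_measurable borel" "g \<in> borel_measurable borel"
    using borel_measurable_integrable[OF f] borel_measurable_integrable[OF g] by auto
  have C [measurable]: "(\<lambda>(x, y). Complex x y) \<in> borel_measurable (half_gaussian \<Otimes>\<^sub>M half_gaussian)"
    unfolding Complex_eq by measurable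
  have cg: "complex_gaussian = distr (half_gaussian \<Otimes>\<^sub>M half_gaussian) borel (\<lambda>(x, y). Complex x y)"
    by (simp add: complex_gaussian_def Let_def)
  have int: "integrable (half_gaussian \<Otimes>\<^sub>M half_gaussian) (\<lambda>(x, y). f x * g y)"
  proof (rule P.Fubini_integrable)
    show "integrable half_gaussian (\<lambda>x. \<integral>y. norm (case (x, y) of (x, y) \<Rightarrow> f x * g y) \<partial>half_gaussian)"
      using f by (simp add: abs_mult)
    show "AE x in half_gaussian. integrable half_gaussian (\<lambda>y. case (x, y) of (x, y) \<Rightarrow> f x * g y)"
      using g by simp
  qed measurable
  show "integrable complex_gaussian (\<lambda>z. f (Re z) * g (Im z))"
    unfolding cg using int
    by (subst integrable_distr_eq) (auto simp: split_beta')
  have "integral\<^sup>L complex_gaussian (\<lambda>z. f (Re z) * g (Im z)) =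
      (\<integral>p. (case p of (x, y) \<Rightarrow> f x * g y) \<partial>(half_gaussian \<Otimes>\<^sub>M half_gaussian))"
    unfolding cg by (subst integral_distr) (auto simp: split_beta')
  also have "\<dots> = (\<integral>x. \<integral>y. f x * g y \<partial>half_gaussian \<partial>half_gaussian)"
    using P.integral_fst'[OF int] by simp
  also have "\<dots> = integral\<^sup>L half_gaussian f * integral\<^sup>L half_gaussian g"
    by simp
  finally show "integral\<^sup>L complex_gaussian (\<lambda>z. f (Re z) * g (Im z)) =
      integral\<^sup>L half_gaussian f * integral\<^sup>L half_gaussian g" .
qed

lemma prob_space_complex_gaussian: "prob_space complex_gaussian"
proof -
  interpret H: prob_space half_gaussian by (rule prob_space_half_gaussian)
  interpret P: pair_prob_space half_gaussian half_gaussian ..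
  show ?thesis
    unfolding complex_gaussian_def Let_def
    by (rule P.prob_space_distr) (unfold Complex_eq, measurable)
qed

lemma sets_complex_gaussian [measurable_cong, simp]: "sets complex_gaussian = sets borel"
  by (simp add: complex_gaussian_def Let_def)

text \<open>Here \<open>z \<bullet> u\<close> is the real inner product of the plane, so each real
  unit direction carries variance 1/2.\<close>

lemma complex_gaussian_moments:
  "integrable complex_gaussian (\<lambda>z. z \<bullet> u)"
  "integrable complex_gaussian (\<lambda>z. (z \<bullet> u)\<^sup>2)"
  "integral\<^sup>L complex_gaussian (\<lambda>z. z \<bullet> u) = 0"
  "integral\<^sup>L complex_gaussian (\<lambda>z. (z \<bullet> u)\<^sup>2) = (norm u)\<^sup>2 / 2"
  "integrable complex_gaussian (\<lambda>z. (norm z) ^ 4)"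
proof -
  interpret H: prob_space half_gaussian by (rule prob_space_half_gaussian)
  note p = half_gaussian_moments(1)
  note x = half_gaussian_moments(1)[of 1, simplified]
  have one: "integrable half_gaussian (\<lambda>_. 1 :: real)" by simp
  note R = complex_gaussian_product[OF x one, simplified]
  note I = complex_gaussian_product[OF one x, simplified]
  note RI = complex_gaussian_product[OF x x]
  note R2 = complex_gaussian_product[OF p[of 2] one, simplified]
  note I2 = complex_gaussian_product[OF one p[of 2], simplified]
  have lin: "z \<bullet> u = Re z * Re u + Im z * Im u" for z :: complex
    by (simp add: inner_complex_def)
  have sq: "(z \<bullet> u)\<^sup>2 = (Re z)\<^sup>2 * (Re u)\<^sup>2 + (Re z * Im z) * (2 * Re u * Im u) + (Im z)\<^sup>2 * (Im u)\<^sup>2"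
    for z :: complex
    by (simp add: lin power2_eq_square algebra_simps)
  show "integrable complex_gaussian (\<lambda>z. z \<bullet> u)"
    unfolding lin using R(1) I(1) by auto
  show "integrable complex_gaussian (\<lambda>z. (z \<bullet> u)\<^sup>2)"
    unfolding sq using R2(1) RI(1) I2(1) by auto
  show "integral\<^sup>L complex_gaussian (\<lambda>z. z \<bullet> u) = 0"
    unfolding lin using R I half_gaussian_moments(2) by (simp add: H.prob_space)
  show "integral\<^sup>L complex_gaussian (\<lambda>z. (z \<bullet> u)\<^sup>2) = (norm u)\<^sup>2 / 2"
  proof -
    have "integral\<^sup>L complex_gaussian (\<lambda>z. (z \<bullet> u)\<^sup>2) =
        integral\<^sup>L complex_gaussian (\<lambda>z. (Re z)\<^sup>2) * (Re u)\<^sup>2 +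
        integral\<^sup>L complex_gaussian (\<lambda>z. Re z * Im z) * (2 * Re u * Im u) +
        integral\<^sup>L complex_gaussian (\<lambda>z. (Im z)\<^sup>2) * (Im u)\<^sup>2"
      unfolding sq using R2(1) RI(1) I2(1) by simp
    then show ?thesis
      using R2(2) RI(2) I2(2) H.prob_space
      by (simp add: half_gaussian_moments cmod_power2 add_divide_distrib)
  qed
  have four: "(norm z) ^ 4 = Re z ^ 4 * 1 + 2 * ((Re z)\<^sup>2 * (Im z)\<^sup>2) + 1 * Im z ^ 4" for z :: complex
  proof -
    have "(norm z) ^ 4 = ((norm z)\<^sup>2)\<^sup>2" by (simp flip: power_mult)
    then show ?thesis
      unfolding cmod_power2 by (simp add: power2_sum flip: power_mult)
  qed
  show "integrable complex_gaussian (\<lambda>z. (norm z) ^ 4)"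
    unfolding four
    by (intro Bochner_Integration.integrable_add integrable_mult_right complex_gaussian_product p one)
qed

section \<open>Orthogonal projection on the range of the fading\<close>

lemma orthonormal_expansion:
  fixes B :: "'a::euclidean_space set"
  assumes B: "finite B" "pairwise orthogonal B" "\<And>b. b \<in> B \<Longrightarrow> norm b = 1"
  shows "v \<in> span B \<Longrightarrow> x \<bullet> v = (\<Sum>b\<in>B. (x \<bullet> b) * (v \<bullet> b))"
    and "(\<Sum>b\<in>B. (x \<bullet> b)\<^sup>2) \<le> (norm x)\<^sup>2"
proof -
  show exp: "x \<bullet> v = (\<Sum>b\<in>B. (x \<bullet> b) * (v \<bullet> b))" if "v \<in> span B" for x v
  proof -
    have "x \<bullet> v = x \<bullet> (\<Sum>b\<in>B. (v \<bullet> b) *\<^sub>R b)"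
      using orthonormal_basis_expand[OF B(2,3) that B(1)] by simp
    then show ?thesis
      by (simp add: inner_sum_right mult.commute)
  qed
  \<comment> \<open>The orthogonal projection of \<open>x\<close> on the span. Both
    \<open>x \<bullet> p\<close> and \<open>p \<bullet> p\<close> equal the sum of squared
    coefficients, and Bessel's inequality is the nonnegativity of the squared length of
    \<open>x - p\<close>.\<close>
  define p where "p = (\<Sum>b\<in>B. (x \<bullet> b) *\<^sub>R b)"
  have p: "p \<in> span B"
    unfolding p_def by (intro span_sum span_scale span_base)
  have "p \<bullet> b = x \<bullet> b" if "b \<in> B" for b
  proof -
    have "p \<bullet> b = (\<Sum>c\<in>B. if c = b then x \<bullet> b else 0)"
      unfolding p_def inner_sum_left
      using B that by (intro sum.cong) (auto simp: pairwise_def real_inner_class.orthogonal_def norm_eq_1)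
    then show ?thesis using B(1) that by simp
  qed
  then have "x \<bullet> p = (\<Sum>b\<in>B. (x \<bullet> b)\<^sup>2)" "p \<bullet> p = (\<Sum>b\<in>B. (x \<bullet> b)\<^sup>2)"
    using exp[OF p] by (simp_all add: power2_eq_square)
  moreover have "0 \<le> (x - p) \<bullet> (x - p)" by simp
  ultimately show "(\<Sum>b\<in>B. (x \<bullet> b)\<^sup>2) \<le> (norm x)\<^sup>2"
    by (simp add: power2_norm_eq_inner inner_diff_left inner_diff_right inner_commute)
qed

text \<open>The range is the real-linear image of a space of real dimension 2 n^2, so the bound does
  not involve the number of rows.\<close>

lemma exists_orthonormal_basis_image:
  fixes A :: "complex^'n::finite^'r::finite"
  shows "\<exists>B. finite B \<and> card B \<le> 2 * (CARD('n))\<^sup>2 \<and> pairwise orthogonal B \<and> (\<forall>b\<in>B. norm b = 1) \<and>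
    (\<forall>X :: complex^'n^'n. A ** X \<in> span B)"
proof -
  have lin: "linear (\<lambda>X :: complex^'n^'n. A ** X)"
    by (rule linearI) (simp_all add: matrix_matrix_mult_def
        Finite_Cartesian_Product.vec_eq_iff scaleR_sum_right ring_distribs sum.distrib)
  let ?V = "range (\<lambda>X :: complex^'n^'n. A ** X)"
  have "subspace ?V"
    using linear_subspace_image[OF lin] by simp
  then obtain B where "B \<subseteq> ?V" and B: "pairwise orthogonal B" "\<And>b. b \<in> B \<Longrightarrow> norm b = 1"
    "independent B" "card B = dim ?V" "span B = ?V"
    by (rule orthonormal_basis_subspace) (rule that)
  have "dim ?V \<le> dim (UNIV :: (complex^'n^'n) set)"
    by (rule dim_image_le[OF lin])
  also have "\<dots> = 2 * (CARD('n))\<^sup>2"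
    by (simp add: power2_eq_square)
  finally show ?thesis
    using B independent_imp_finite by (intro exI[of _ B]) auto
qed

text \<open>The noise is sampled as one flat family of scalars, so that all entries are coordinates
  of one product measure; this reassembles the matrix added to block \<open>i\<close> by
  \<open>channel_output\<close>.\<close>

definition noise_block :: "(nat \<times> 'r::finite \<times> 'n::finite \<Rightarrow> complex) \<Rightarrow> nat \<Rightarrow> complex^'n^'r" where
  "noise_block w i = (\<chi> a b. w (i, a, b))"

lemma sum_block:
  "(\<Sum>q\<in>{i} \<times> (UNIV :: ('r::finite \<times> 'n::finite) set). f q) = (\<Sum>a\<in>UNIV. \<Sum>b\<in>UNIV. f (i, a, b))"
  by (simp only: UNIV_Times_UNIV[symmetric] sum.cartesian_product') simp

lemma noise_block_inner:
  "noise_block w i \<bullet> u = (\<Sum>q\<in>{i} \<times> UNIV. w q \<bullet> (u $ fst (snd q) $ snd (snd q)))"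
  by (simp add: noise_block_def inner_vec_def sum_block)

lemma norm_noise_block_square:
  "(norm (noise_block w i))\<^sup>2 = (\<Sum>q\<in>{i} \<times> UNIV. (norm (w q))\<^sup>2)"
  by (simp add: noise_block_def norm_vec_def L2_set_def sum_nonneg sum_block)

lemma prob_space_noise: "prob_space (noise k)"
  unfolding noise_def by (intro prob_space_PiM prob_space_complex_gaussian)

lemma noise_coordinate:
  fixes f :: "complex \<Rightarrow> real"
  assumes q: "q \<in> {1..k} \<times> (UNIV :: ('r::finite \<times> 'n::finite) set)" and f: "integrable complex_gaussian f"
  shows "integrable (noise k) (\<lambda>w. f (w q))"
    and "(\<integral>w. f (w q) \<partial>noise k) = integral\<^sup>L complex_gaussian f"
proof -
  have [measurable]: "f \<in> borel_measurable borel"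
    using borel_measurable_integrable[OF f] by simp
  have [measurable]: "(\<lambda>w. w q) \<in> measurable (noise k) complex_gaussian"
    unfolding noise_def using q by (intro measurable_component_singleton) auto
  have "distr (noise k) complex_gaussian (\<lambda>w. w q) = complex_gaussian"
    unfolding noise_def using q
    by (intro distr_PiM_component) (auto intro: prob_space_complex_gaussian)
  then have d: "complex_gaussian = distr (noise k) complex_gaussian (\<lambda>w. w q)" ..
  show "integrable (noise k) (\<lambda>w. f (w q))"
    using f by (subst (asm) d) (simp add: integrable_distr_eq)
  show "(\<integral>w. f (w q) \<partial>noise k) = integral\<^sup>L complex_gaussian f"
    by (subst d) (simp add: integral_distr)
qed

lemma indep_noise:
  assumes "k > 0"
  shows "prob_space.indep_vars (noise k :: (nat \<times> 'r::finite \<times> 'n::finite \<Rightarrow> complex) measure)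
    (\<lambda>_. complex_gaussian) (\<lambda>q w. w q) ({1..k} \<times> UNIV)"
  unfolding noise_def UNIV_Times_UNIV
  by (rule indep_vars_PiM_coordinates) (use assms in \<open>auto intro: prob_space_complex_gaussian\<close>)

text \<open>Isotropy of the noise: the entries contribute independent centred terms of variance
  |u_q|^2 / 2, so the second moment is the sum of these variances.\<close>

lemma expectation_noise_block_inner:
  fixes u :: "complex^'n::finite^'r::finite"
  assumes i: "i \<in> {1..k}"
  shows "integrable (noise k) (\<lambda>w. (noise_block w i \<bullet> u)\<^sup>2)"
    and "(\<integral>w. (noise_block w i \<bullet> u)\<^sup>2 \<partial>noise k) = (norm u)\<^sup>2 / 2"
proof -
  interpret prob_space "noise k :: (nat \<times> 'r \<times> 'n \<Rightarrow> complex) measure"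
    by (rule prob_space_noise)
  let ?J = "{i} \<times> (UNIV :: ('r \<times> 'n) set)"
  let ?u = "\<lambda>q. u $ fst (snd q) $ snd (snd q)"
  define X where "X q w = w q \<bullet> ?u q" for q and w :: "nat \<times> 'r \<times> 'n \<Rightarrow> complex"
  have J: "?J \<subseteq> {1..k} \<times> UNIV" using i by auto
  have "indep_vars (\<lambda>_. complex_gaussian) (\<lambda>q w. w q) ?J"
    using i by (intro indep_vars_subset[OF indep_noise J]) auto
  then have ind: "indep_vars (\<lambda>_. borel) X ?J"
    unfolding X_def
    by (rule indep_vars_compose2[where Y = "\<lambda>q z. z \<bullet> ?u q"]) simp
  note c1 = noise_coordinate[OF subsetD[OF J] complex_gaussian_moments(1)]
  note c2 = noise_coordinate[OF subsetD[OF J] complex_gaussian_moments(2)]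
  have sq: "integrable (noise k) (\<lambda>w. (X q w)\<^sup>2)" if "q \<in> ?J" for q
    unfolding X_def by (rule c2(1)[OF that])
  have EX: "expectation (X q) = 0" if "q \<in> ?J" for q
    unfolding X_def c1(2)[OF that] by (rule complex_gaussian_moments(3))
  have EX2: "expectation (\<lambda>w. (X q w)\<^sup>2) = (norm (?u q))\<^sup>2 / 2" if "q \<in> ?J" for q
    unfolding X_def c2(2)[OF that] by (rule complex_gaussian_moments(4))
  have W: "noise_block w i \<bullet> u = (\<Sum>q\<in>?J. X q w)" for w
    unfolding noise_block_inner X_def by simp
  show "integrable (noise k) (\<lambda>w. (noise_block w i \<bullet> u)\<^sup>2)"
    unfolding W by (rule variance_sum_indep_vars(1)[OF _ ind sq]) auto
  have int: "integrable (noise k) (X q)" if "q \<in> ?J" for q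
    unfolding X_def by (rule c1(1)[OF that])
  have "expectation (\<lambda>w. \<Sum>q\<in>?J. X q w) = (\<Sum>q\<in>?J. expectation (X q))"
    using int by (rule Bochner_Integration.integral_sum)
  also have "\<dots> = 0" using EX by (rule sum.neutral[OF ballI])
  finally have "(\<integral>w. (noise_block w i \<bullet> u)\<^sup>2 \<partial>noise k) = variance (\<lambda>w. \<Sum>q\<in>?J. X q w)"
    unfolding W by simp
  also have "\<dots> = (\<Sum>q\<in>?J. variance (X q))"
    by (rule variance_sum_indep_vars(2)[OF _ ind sq]) auto
  also have "\<dots> = (\<Sum>q\<in>?J. (norm (?u q))\<^sup>2 / 2)"
    by (intro sum.cong refl) (simp only: EX EX2 diff_zero)
  also have "\<dots> = (norm u)\<^sup>2 / 2"
    unfolding sum_divide_distrib[symmetric]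
    by (simp add: norm_vec_def L2_set_def sum_nonneg sum_block)
  finally show "(\<integral>w. (noise_block w i \<bullet> u)\<^sup>2 \<partial>noise k) = (norm u)\<^sup>2 / 2" .
qed

text \<open>A block has \<open>?m\<close> entries. Cauchy-Schwarz for the square of a sum of
  \<open>?m\<close> terms costs one factor \<open>?m\<close>, and adding \<open>?m\<close> equal
  fourth moments gives the other.\<close>

lemma expectation_norm_noise_block:
  assumes i: "i \<in> {1..k}"
  defines "c \<equiv> (real CARD('r::finite) * real CARD('n::finite))\<^sup>2 * (\<integral>z. (norm z) ^ 4 \<partial>complex_gaussian)"
  shows "integrable (noise k :: (nat \<times> 'r \<times> 'n \<Rightarrow> complex) measure) (\<lambda>w. (norm (noise_block w i)) ^ 4)"
    and "(\<integral>w. (norm (noise_block w i)) ^ 4 \<partial>(noise k :: (nat \<times> 'r \<times> 'n \<Rightarrow> complex) measure)) \<le> c"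
proof -
  let ?J = "{i} \<times> (UNIV :: ('r \<times> 'n) set)"
  let ?m = "real CARD('r) * real CARD('n)"
  have J: "?J \<subseteq> {1..k} \<times> UNIV" using i by auto
  note c4 = noise_coordinate[OF subsetD[OF J] complex_gaussian_moments(5)]
  have le: "(norm (noise_block w i)) ^ 4 \<le> ?m * (\<Sum>q\<in>?J. (norm (w q)) ^ 4)"
    for w :: "nat \<times> 'r \<times> 'n \<Rightarrow> complex"
  proof -
    have "(norm (noise_block w i)) ^ 4 = ((norm (noise_block w i))\<^sup>2)\<^sup>2"
      by (simp flip: power_mult)
    also have "\<dots> = (\<Sum>q\<in>?J. (norm (w q))\<^sup>2)\<^sup>2"
      unfolding norm_noise_block_square by simp
    also have "\<dots> \<le> (\<Sum>q\<in>?J. ((norm (w q))\<^sup>2)\<^sup>2) * real (card ?J)"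
      by (rule sum_squared_le_sum_of_squares)
    finally show ?thesis
      by (simp add: mult.commute card_cartesian_product flip: power_mult UNIV_Times_UNIV)
  qed
  have int: "integrable (noise k) (\<lambda>w. ?m * (\<Sum>q\<in>?J. (norm (w q)) ^ 4))"
    using c4(1) by (intro integrable_mult_right Bochner_Integration.integrable_sum)
  have [measurable]: "(\<lambda>w. w q) \<in> borel_measurable (noise k)" if "q \<in> ?J" for q
  proof -
    have "(\<lambda>w. w q) \<in> measurable (noise k) complex_gaussian"
      unfolding noise_def using subsetD[OF J that] by (intro measurable_component_singleton) auto
    then show ?thesis
      by (subst (asm) measurable_cong_sets[OF refl sets_complex_gaussian])
  qed
  have "(\<lambda>w. ((norm (noise_block w i))\<^sup>2)\<^sup>2) \<in> borel_measurable (noise k :: (nat \<times> 'r \<times> 'n \<Rightarrow> complex) measure)"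
    unfolding norm_noise_block_square by measurable
  then have meas: "(\<lambda>w. (norm (noise_block w i)) ^ 4) \<in> borel_measurable (noise k :: (nat \<times> 'r \<times> 'n \<Rightarrow> complex) measure)"
    by (simp flip: power_mult)
  show int4: "integrable (noise k :: (nat \<times> 'r \<times> 'n \<Rightarrow> complex) measure) (\<lambda>w. (norm (noise_block w i)) ^ 4)"
    by (rule Bochner_Integration.integrable_bound[OF int meas])
      (use order_trans[OF le abs_ge_self] in \<open>simp add: AE_I2\<close>)
  have "(\<integral>w. (norm (noise_block w i)) ^ 4 \<partial>(noise k :: (nat \<times> 'r \<times> 'n \<Rightarrow> complex) measure)) \<le>
      (\<integral>w. ?m * (\<Sum>q\<in>?J. (norm (w q)) ^ 4) \<partial>noise k)"
    by (rule integral_mono[OF int4 int le])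
  also have "\<dots> = ?m * (\<Sum>q\<in>?J. \<integral>w. (norm (w q)) ^ 4 \<partial>noise k)"
    using c4(1) by (subst integral_mult_right_zero, subst Bochner_Integration.integral_sum) auto
  also have "\<dots> = c"
    unfolding c_def using c4(2)
    by (simp add: power2_eq_square card_cartesian_product flip: UNIV_Times_UNIV)
  finally show "(\<integral>w. (norm (noise_block w i)) ^ 4 \<partial>(noise k :: (nat \<times> 'r \<times> 'n \<Rightarrow> complex) measure)) \<le> c" .
qed

text \<open>\<open>Z w\<close> is the squared norm of the noise projected blockwise on the range of
  \<open>h\<close>. It depends on \<open>h\<close> but not on \<open>l\<close>, and its tail bound
  does not depend on \<open>h\<close>.\<close>

lemma noise_projection_tail:
  fixes h :: "('n::finite, 'r::finite) rblocks"
  assumes k: "k > 0"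
  defines "c \<equiv> (real CARD('r) * real CARD('n))\<^sup>2 * (\<integral>z. (norm z) ^ 4 \<partial>complex_gaussian)"
  obtains Z :: "(nat \<times> 'r \<times> 'n \<Rightarrow> complex) \<Rightarrow> real" where "Z \<in> borel_measurable (noise k)"
    and "\<And>w (l :: 'n blocks). (\<Sum>i=1..k. noise_block w i \<bullet> (h i ** l i))\<^sup>2 \<le> Z w * (\<Sum>i=1..k. (norm (h i ** l i))\<^sup>2)"
    and "\<And>t. 0 < t \<Longrightarrow> measure (noise k) {w \<in> space (noise k). real k * (real CARD('n))\<^sup>2 + t \<le> Z w}
      \<le> real k * c / t\<^sup>2"
proof -
  interpret prob_space "noise k :: (nat \<times> 'r \<times> 'n \<Rightarrow> complex) measure"
    by (rule prob_space_noise)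
  obtain B where B: "\<And>i. finite (B i)" "\<And>i. card (B i) \<le> 2 * (CARD('n))\<^sup>2"
    "\<And>i. pairwise orthogonal (B i)" "\<And>i b. b \<in> B i \<Longrightarrow> norm b = 1"
    "\<And>i (X :: complex^'n^'n). h i ** X \<in> span (B i)"
    using exists_orthonormal_basis_image[of "h i" for i] by metis
  have ex1: "x \<bullet> (h i ** X) = (\<Sum>b\<in>B i. (x \<bullet> b) * ((h i ** X) \<bullet> b))" for x i and X :: "complex^'n^'n"
    by (rule orthonormal_expansion(1)[OF B(1)[of i] B(3)[of i] B(4)[of _ i] B(5)])
  have ex2: "(\<Sum>b\<in>B i. (x \<bullet> b)\<^sup>2) \<le> (norm x)\<^sup>2" for x i
    by (rule orthonormal_expansion(2)[OF B(1)[of i] B(3)[of i] B(4)[of _ i]])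
  define Zi where "Zi i w = (\<Sum>b\<in>B i. (noise_block w i \<bullet> b)\<^sup>2)" for i and w :: "nat \<times> 'r \<times> 'n \<Rightarrow> complex"
  let ?K = "\<lambda>i :: nat. {i} \<times> (UNIV :: ('r \<times> 'n) set)"
  \<comment> \<open>Independence of the scalar entries passes to the groups of entries forming the
    blocks; \<open>Zi i\<close> reads only group \<open>i\<close>, so restricting \<open>w\<close>
    to that group leaves it unchanged.\<close>
  have "indep_vars (\<lambda>i. PiM (?K i) (\<lambda>_. complex_gaussian)) (\<lambda>i w. \<lambda>q\<in>?K i. w q) {1..k}"
    by (rule indep_vars_restrict[OF indep_noise[OF k]]) (auto simp: disjoint_family_on_def)
  then have "indep_vars (\<lambda>_. borel) (\<lambda>i w. Zi i (\<lambda>q\<in>?K i. w q)) {1..k}"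
  proof (rule indep_vars_compose2)
    fix i
    have [measurable]: "(\<lambda>w. w q) \<in> borel_measurable (PiM (?K i) (\<lambda>_. complex_gaussian))" if "q \<in> ?K i" for q
      using measurable_component_singleton[OF that, of "\<lambda>_. complex_gaussian"]
      by (subst (asm) measurable_cong_sets[OF refl sets_complex_gaussian])
    show "Zi i \<in> borel_measurable (PiM (?K i) (\<lambda>_. complex_gaussian))"
      unfolding Zi_def noise_block_inner by measurable
  qed
  also have "(\<lambda>i w. Zi i (\<lambda>q\<in>?K i. w q)) = Zi"
    by (simp add: Zi_def noise_block_def fun_eq_iff)
  finally have ind: "indep_vars (\<lambda>_. borel) Zi {1..k}" .
  \<comment> \<open>By Bessel, the projected noise is dominated by the whole block, whose fourth
    moment then controls the second moment of \<open>Zi i\<close>.\<close>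
  have Zi4: "(Zi i w)\<^sup>2 \<le> (norm (noise_block w i)) ^ 4" for i w
  proof -
    have "Zi i w \<le> (norm (noise_block w i))\<^sup>2"
      unfolding Zi_def by (rule ex2)
    then have "(Zi i w)\<^sup>2 \<le> ((norm (noise_block w i))\<^sup>2)\<^sup>2"
      by (rule power_mono) (simp add: Zi_def sum_nonneg)
    then show ?thesis by (simp flip: power_mult)
  qed
  have Zi_meas: "Zi i \<in> borel_measurable (noise k)" if "i \<in> {1..k}" for i
    using ind that by (auto simp: indep_vars_def)
  have sq: "integrable (noise k) (\<lambda>w. (Zi i w)\<^sup>2)" if "i \<in> {1..k}" for i
    by (rule Bochner_Integration.integrable_bound[OF expectation_norm_noise_block(1)[OF that]])
      (use Zi4 Zi_meas[OF that] in \<open>auto intro: order_trans\<close>)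
  have "expectation (\<lambda>w. (Zi i w)\<^sup>2) \<le> c" if "i \<in> {1..k}" for i
    using integral_mono[OF sq[OF that] expectation_norm_noise_block(1)[OF that] Zi4]
      expectation_norm_noise_block(2)[OF that] unfolding c_def by (rule order_trans)
  moreover have "expectation (Zi i) \<le> (real CARD('n))\<^sup>2" if "i \<in> {1..k}" for i
  proof -
    have "expectation (Zi i) = (\<Sum>b\<in>B i. expectation (\<lambda>w. (noise_block w i \<bullet> b)\<^sup>2))"
      unfolding Zi_def using expectation_noise_block_inner(1)[OF that]
      by (rule Bochner_Integration.integral_sum)
    \<comment> \<open>At most 2 n^2 unit directions of variance 1/2 each: this is the mean n^2 per
      block.\<close>
    also have "\<dots> = (\<Sum>b\<in>B i. 1 / 2)"
      by (intro sum.cong refl) (simp add: expectation_noise_block_inner(2)[OF that] B(4))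
    also have "\<dots> \<le> (real CARD('n))\<^sup>2"
      using of_nat_mono[OF B(2)[of i], where 'a = real] by simp
    finally show ?thesis .
  qed
  ultimately have tail: "prob {w \<in> space (noise k). real (card {1..k}) * (real CARD('n))\<^sup>2 + t \<le> (\<Sum>i=1..k. Zi i w)}
      \<le> real (card {1..k}) * c / t\<^sup>2" if "0 < t" for t
    using that by (intro sum_indep_vars_upper_tail[OF _ ind sq]) auto
  show thesis
  proof (rule that[of "\<lambda>w. \<Sum>i=1..k. Zi i w"])
    show "(\<lambda>w. \<Sum>i=1..k. Zi i w) \<in> borel_measurable (noise k)"
      using Zi_meas by (rule borel_measurable_sum)
    show "(\<Sum>i=1..k. noise_block w i \<bullet> (h i ** l i))\<^sup>2 \<le>
        (\<Sum>i=1..k. Zi i w) * (\<Sum>i=1..k. (norm (h i ** l i))\<^sup>2)"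
      for w and l :: "'n blocks"
    proof -
      \<comment> \<open>A single Cauchy-Schwarz over all pairs of a block and a basis vector. The
        second factor is again the full squared norm by Parseval, since \<open>h i ** l i\<close>
        lies in the span of \<open>B i\<close>.\<close>
      let ?S = "Sigma {1..k} B"
      have "(\<Sum>i=1..k. noise_block w i \<bullet> (h i ** l i)) =
          (\<Sum>i=1..k. \<Sum>b\<in>B i. (noise_block w i \<bullet> b) * ((h i ** l i) \<bullet> b))"
        by (intro sum.cong refl ex1)
      also have "\<dots> = (\<Sum>(i, b)\<in>?S. (noise_block w i \<bullet> b) * ((h i ** l i) \<bullet> b))"
        using B(1) by (subst sum.Sigma) auto
      finally have "(\<Sum>i=1..k. noise_block w i \<bullet> (h i ** l i))\<^sup>2 =
          (\<Sum>p\<in>?S. (noise_block w (fst p) \<bullet> snd p) * ((h (fst p) ** l (fst p)) \<bullet> snd p))\<^sup>2"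
        by (simp add: split_beta')
      also have "\<dots> \<le> (\<Sum>p\<in>?S. (noise_block w (fst p) \<bullet> snd p)\<^sup>2) *
          (\<Sum>p\<in>?S. ((h (fst p) ** l (fst p)) \<bullet> snd p)\<^sup>2)"
        by (rule Cauchy_Schwarz_ineq_sum)
      also have "(\<Sum>p\<in>?S. (noise_block w (fst p) \<bullet> snd p)\<^sup>2) = (\<Sum>i=1..k. Zi i w)"
        unfolding Zi_def using B(1) by (subst sum.Sigma) (auto simp: split_beta')
      also have "(\<Sum>p\<in>?S. ((h (fst p) ** l (fst p)) \<bullet> snd p)\<^sup>2) =
          (\<Sum>i=1..k. \<Sum>b\<in>B i. ((h i ** l i) \<bullet> b)\<^sup>2)"
        using B(1) by (subst sum.Sigma) (auto simp: split_beta')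
      also have "\<dots> = (\<Sum>i=1..k. (norm (h i ** l i))\<^sup>2)"
        by (intro sum.cong refl) (subst power2_norm_eq_inner, subst ex1, simp add: power2_eq_square)
      finally show ?thesis .
    qed
  qed (use tail in simp)
qed

section \<open>Existence of shifts\<close>

lemma block_inner_eq:
  fixes X Y :: "'n::finite blocks"
  shows "block_inner k X Y = (\<Sum>i=1..k. X i \<bullet> Y i)"
proof -
  have "Re (trace (A ** conj_transpose B)) = A \<bullet> B" for A B :: "complex^'n^'n"
    by (simp add: trace_def matrix_matrix_mult_def conj_transpose_def map_matrix_def
        Finite_Cartesian_Product.transpose_def inner_vec_def inner_complex_def)
  then show ?thesis
    by (simp add: block_inner_def)
qed

lemma block_norm_square: "(block_norm k X)\<^sup>2 = (\<Sum>i=1..k. (norm (X i))\<^sup>2)"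
  by (simp add: block_norm_def L2_set_def sum_nonneg)

text \<open>The squared Frobenius norm read in coefficient space.\<close>

lemma quad_form_gram:
  "quad_form d (\<lambda>i j. block_inner k (b i) (b j)) x = (\<Sum>i=1..k. (norm (\<Sum>j<d. x j *\<^sub>R b j i))\<^sup>2)"
proof -
  have "quad_form d (\<lambda>i j. block_inner k (b i) (b j)) x =
      (\<Sum>p<d. \<Sum>q<d. \<Sum>i=1..k. (x p *\<^sub>R b p i) \<bullet> (x q *\<^sub>R b q i))"
    unfolding quad_form_def block_inner_eq
    by (intro sum.cong refl) (simp add: sum_distrib_left sum_distrib_right mult_ac)
  also have "\<dots> = (\<Sum>p<d. \<Sum>i=1..k. \<Sum>q<d. (x p *\<^sub>R b p i) \<bullet> (x q *\<^sub>R b q i))"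
    by (intro sum.cong refl sum.swap)
  also have "\<dots> = (\<Sum>i=1..k. \<Sum>p<d. \<Sum>q<d. (x p *\<^sub>R b p i) \<bullet> (x q *\<^sub>R b q i))"
    by (rule sum.swap)
  finally show ?thesis
    by (simp only: power2_norm_eq_inner inner_sum_left inner_sum_right)
      (rule sum.cong[OF refl], rule sum.swap)
qed

lemma pos_def_gram:
  assumes "lattice_basis k d b L"
  shows "pos_def d (\<lambda>i j. block_inner k (b i) (b j))"
  unfolding pos_def_def
proof (intro conjI allI impI)
  fix x :: "nat \<Rightarrow> real"
  assume nz: "\<exists>i<d. x i \<noteq> 0"
  have "\<not> (\<forall>i\<in>{1..k}. (\<Sum>j<d. x j *\<^sub>R b j i) = 0)"
    using assms nz unfolding lattice_basis_def by blast
  then obtain i where i: "i \<in> {1..k}" "(\<Sum>j<d. x j *\<^sub>R b j i) \<noteq> 0"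
    by blast
  have "0 < (\<Sum>i=1..k. (norm (\<Sum>j<d. x j *\<^sub>R b j i))\<^sup>2)"
    by (rule sum_pos2[OF _ i(1)]) (use i(2) in auto)
  then show "0 < quad_form d (\<lambda>i j. block_inner k (b i) (b j)) x"
    unfolding quad_form_gram .
qed (simp add: block_inner_eq inner_commute)

lemma some_lattice_basis:
  assumes "is_lattice k d L"
  shows "lattice_basis k d (SOME b. lattice_basis k d b L) L"
  using assms unfolding is_lattice_def by (rule someI_ex)

lemma lattice_vol_pos:
  assumes "is_lattice k d L"
  shows "0 < lattice_vol k d L"
  using det_pos_def[OF pos_def_gram[OF some_lattice_basis[OF assms]]]
  by (simp add: lattice_vol_def gram_det_def)

lemma C_nk_pos: "n > 0 \<Longrightarrow> k > 0 \<Longrightarrow> 0 < C_nk n k"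
  by (simp add: C_nk_def)

lemma scaling_square:
  fixes L :: "'n::finite blocks set"
  assumes "P > 0" and "k > 0" and "is_lattice k (2 * CARD('n)\<^sup>2 * k) L"
  shows "(scaling P R k L)\<^sup>2 =
    C_nk CARD('n) k powr (1 / (real CARD('n) ^ 2 * real k)) * P /
    (2 powr (R / real CARD('n)) * lattice_vol k (2 * CARD('n)\<^sup>2 * k) L powr (1 / (real CARD('n) ^ 2 * real k)))"
    and "0 < scaling P R k L"
proof -
  have "0 < C_nk CARD('n) k"
    using assms(2) by (intro C_nk_pos) simp_all
  moreover note lattice_vol_pos[OF assms(3)]
  ultimately show "(scaling P R k L)\<^sup>2 =
    C_nk CARD('n) k powr (1 / (real CARD('n) ^ 2 * real k)) * P /
    (2 powr (R / real CARD('n)) * lattice_vol k (2 * CARD('n)\<^sup>2 * k) L powr (1 / (real CARD('n) ^ 2 * real k)))"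
    and "0 < scaling P R k L"
    using assms(1) by (auto simp: scaling_def Let_def)
qed

text \<open>The exponent is the real dimension, so this is the factor by which the scaling changes
  the covolume; raising to this power clears the roots in the definition of the scaling.\<close>

lemma scaling_power:
  fixes L :: "'n::finite blocks set"
  assumes P: "P > 0" and k: "k > 0" and L: "is_lattice k (2 * CARD('n)\<^sup>2 * k) L"
  shows "(scaling P R k L) ^ (2 * CARD('n)\<^sup>2 * k) =
    C_nk CARD('n) k * P ^ (CARD('n)\<^sup>2 * k) /
    (2 powr (R * real CARD('n) * real k) * lattice_vol k (2 * CARD('n)\<^sup>2 * k) L)"
proof -
  define N where "N = CARD('n)\<^sup>2 * k"
  have N: "N > 0" using k by (simp add: N_def)
  have root: "(t powr (1 / real N)) ^ N = t" if "t > 0" for t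
    using that N by (simp add: powr_realpow[symmetric] powr_powr)
  have "(2 powr (R / real CARD('n))) ^ N = 2 powr (R * real CARD('n) * real k)"
    by (simp add: powr_realpow[symmetric] powr_powr N_def power2_eq_square mult.assoc)
  moreover have "(scaling P R k L) ^ (2 * CARD('n)\<^sup>2 * k) = ((scaling P R k L)\<^sup>2) ^ N"
    by (simp add: N_def power_mult mult.assoc)
  moreover have "real CARD('n) ^ 2 * real k = real N"
    by (simp add: N_def)
  moreover have "0 < C_nk CARD('n) k"
    using k by (intro C_nk_pos) simp_all
  ultimately show ?thesis
    unfolding scaling_square(1)[OF P k L]
    by (simp add: power_divide power_mult_distrib root lattice_vol_pos[OF L] flip: N_def)
qed

text \<open>In coefficients the ball divided by \<alpha> is the ellipsoid \<open>U\<close>, of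
  volume exactly 2^(Rnk). A translate \<open>c\<close> of the integer grid with at least that many
  points in \<open>U\<close> gives the shift \<open>XR\<close> with coefficients \<alpha>
  \<open>c\<close>.\<close>

lemma ex_good_shift:
  fixes L :: "'n::finite blocks set"
  assumes P: "P > 0" and k: "k > 0" and L: "is_lattice k (2 * CARD('n)\<^sup>2 * k) L"
  shows "\<exists>XR. good_shift P R k L XR"
proof -
  define N where "N = CARD('n)\<^sup>2 * k"
  define d where "d = 2 * CARD('n)\<^sup>2 * k"
  \<comment> \<open>The same choice as in \<open>lattice_vol\<close>, so that the covolume is
    literally the root of the determinant of \<open>G\<close>.\<close>
  define b where "b = (SOME b. lattice_basis k d b L)"
  define \<alpha> where "\<alpha> = scaling P R k L"
  define r where "r = sqrt (P * real k * real CARD('n))"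
  define G where "G = (\<lambda>i j. block_inner k (b i) (b j))"
  let ?M = "PiM {..<d} (\<lambda>_. lborel :: real measure)"
  have b: "lattice_basis k d b L"
    unfolding b_def d_def by (rule some_lattice_basis[OF L])
  have \<alpha>: "0 < \<alpha>"
    unfolding \<alpha>_def by (rule scaling_square(2)[OF P k L])
  have r: "0 < r" using P k by (simp add: r_def)
  have G: "pos_def d G"
    unfolding G_def by (rule pos_def_gram[OF b])
  have vol: "lattice_vol k d L = sqrt (Determinant.det (Matrix.mat d d (\<lambda>(i, j). G i j)))"
    by (simp add: lattice_vol_def gram_det_def G_def b_def)
  have d: "d = 2 * N" by (simp add: d_def N_def)
  define U where "U = {x \<in> space ?M. quad_form d G x \<le> (r / \<alpha>)\<^sup>2}"
  have U: "U \<in> sets ?M"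
    unfolding U_def by measurable
  have "emeasure ?M U = ennreal (unit_ball_vol (real d) * (r / \<alpha>) ^ d / lattice_vol k d L)"
    unfolding U_def vol using r \<alpha> by (intro emeasure_ellipsoid[OF G]) simp
  \<comment> \<open>In the even dimension 2N the unit ball has volume pi^N / N!. Hence the numerator
    is \<open>C_nk\<close> times P^N, which cancels against the same product in \<alpha>^d and
    leaves the power of 2.\<close>
  also have "unit_ball_vol (real d) * (r / \<alpha>) ^ d / lattice_vol k d L = 2 powr (R * real CARD('n) * real k)"
  proof -
    have "r ^ d = (P * real k * real CARD('n)) ^ N"
      using P by (simp add: d power_mult r_def)
    moreover have "\<alpha> ^ d = C_nk CARD('n) k * P ^ N /
        (2 powr (R * real CARD('n) * real k) * lattice_vol k d L)"
      unfolding \<alpha>_def d_def N_def by (rule scaling_power[OF P k L])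
    moreover have "0 < lattice_vol k d L"
      unfolding d_def by (rule lattice_vol_pos[OF L])
    moreover have "unit_ball_vol (real d) = pi ^ N / fact N"
      unfolding d by (rule unit_ball_vol_even)
    moreover have "C_nk CARD('n) k = (pi * real CARD('n) * real k) ^ N / fact N"
      by (simp add: C_nk_def N_def)
    ultimately show ?thesis
      using P k by (simp add: power_divide power_mult_distrib)
  qed
  finally have V: "emeasure ?M U = ennreal (2 powr (R * real CARD('n) * real k))" .
  obtain c where c: "finite {z \<in> {..<d} \<rightarrow>\<^sub>E (UNIV :: int set). (\<lambda>i\<in>{..<d}. c i + real_of_int (z i)) \<in> U}"
    "emeasure ?M U \<le> of_nat (card {z \<in> {..<d} \<rightarrow>\<^sub>E (UNIV :: int set). (\<lambda>i\<in>{..<d}. c i + real_of_int (z i)) \<in> U})"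
    using ex_translate_many_integer_points[OF _ U] V by (auto simp: Let_def)
  define Z where "Z = {z \<in> {..<d} \<rightarrow>\<^sub>E (UNIV :: int set). (\<lambda>i\<in>{..<d}. c i + real_of_int (z i)) \<in> U}"
  have card_Z: "2 powr (R * real CARD('n) * real k) \<le> real (card Z)"
    using c(2) unfolding V Z_def[symmetric] by (simp add: ennreal_of_nat_eq_real_of_nat)
  define XR where "XR = (\<lambda>i\<in>{1..k}. \<alpha> *\<^sub>R (\<Sum>j<d. c j *\<^sub>R b j i))"
  define f where "f z = (\<lambda>i\<in>{1..k}. XR i + \<alpha> *\<^sub>R (\<lambda>i\<in>{1..k}. \<Sum>j<d. real_of_int (z j) *\<^sub>R b j i) i)"
    for z :: "nat \<Rightarrow> int"
  have f: "f z i = \<alpha> *\<^sub>R (\<Sum>j<d. (c j + real_of_int (z j)) *\<^sub>R b j i)" if "i \<in> {1..k}" for z i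
    using that by (simp add: f_def XR_def scaleR_left_distrib sum.distrib scaleR_right_distrib)
  have norm_f: "(block_norm k (f z))\<^sup>2 = \<alpha>\<^sup>2 * quad_form d G (\<lambda>i\<in>{..<d}. c i + real_of_int (z i))" for z
  proof -
    have "(block_norm k (f z))\<^sup>2 = (\<Sum>i=1..k. \<alpha>\<^sup>2 * (norm (\<Sum>j<d. (c j + real_of_int (z j)) *\<^sub>R b j i))\<^sup>2)"
      unfolding block_norm_square by (intro sum.cong refl) (simp add: f power_mult_distrib)
    also have "\<dots> = \<alpha>\<^sup>2 * quad_form d G (\<lambda>j. c j + real_of_int (z j))"
      by (simp add: G_def quad_form_gram sum_distrib_left)
    also have "quad_form d G (\<lambda>j. c j + real_of_int (z j)) = quad_form d G (\<lambda>i\<in>{..<d}. c i + real_of_int (z i))"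
      by (rule quad_form_cong) simp
    finally show ?thesis .
  qed
  have small: "block_norm k (f z) \<le> r \<longleftrightarrow> (\<lambda>i\<in>{..<d}. c i + real_of_int (z i)) \<in> U" for z
  proof -
    have "0 \<le> block_norm k (f z)" by (simp add: block_norm_def)
    then have "block_norm k (f z) \<le> r \<longleftrightarrow> (block_norm k (f z))\<^sup>2 \<le> r\<^sup>2"
      using r by (simp add: power2_le_iff_abs_le)
    also have "\<dots> \<longleftrightarrow> quad_form d G (\<lambda>i\<in>{..<d}. c i + real_of_int (z i)) \<le> (r / \<alpha>)\<^sup>2"
      unfolding norm_f using \<alpha> by (simp add: power_divide pos_le_divide_eq mult.commute)
    finally show ?thesis
      by (simp add: U_def space_PiM)
  qed
  have "L = {\<lambda>i\<in>{1..k}. \<Sum>j<d. real_of_int (z j) *\<^sub>R b j i | z :: nat \<Rightarrow> int. True}"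
    using b by (simp add: lattice_basis_def)
  then have "shifted_lattice P R k L XR = range f"
    unfolding shifted_lattice_def f_def \<alpha>_def[symmetric] by blast
  then have code: "code P R k L XR = f ` Z"
  proof (intro equalityI subsetI)
    fix X assume "X \<in> code P R k L XR"
    then obtain z where z: "X = f z" "block_norm k (f z) \<le> r"
      using \<open>shifted_lattice P R k L XR = range f\<close> by (auto simp: code_def r_def)
    \<comment> \<open>Integer vectors in the lattice description are arbitrary beyond
      \<open>d\<close>, whereas the counted ones are \<open>undefined\<close> there.\<close>
    have "f z = f (restrict z {..<d})"
      unfolding f_def by (intro restrict_ext) simp
    moreover have "restrict z {..<d} \<in> Z"
      using z(2) unfolding small Z_def by (auto cong: restrict_cong)
    ultimately show "X \<in> f ` Z"
      using z(1) by blast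
  next
    fix X assume "X \<in> f ` Z"
    then show "X \<in> code P R k L XR"
      using small \<open>shifted_lattice P R k L XR = range f\<close>
      unfolding code_def r_def[symmetric] Z_def by auto
  qed
  \<comment> \<open>The code counts matrices and \<open>Z\<close> counts coefficient vectors; linear
    independence identifies the two numbers.\<close>
  have "inj_on f Z"
  proof (rule inj_onI)
    fix z w assume z: "z \<in> Z" and w: "w \<in> Z" and eq: "f z = f w"
    have "\<forall>i\<in>{1..k}. (\<Sum>j<d. (real_of_int (z j) - real_of_int (w j)) *\<^sub>R b j i) = 0"
    proof
      fix i assume i: "i \<in> {1..k}"
      have "f z i = f w i" using eq by simp
      then show "(\<Sum>j<d. (real_of_int (z j) - real_of_int (w j)) *\<^sub>R b j i) = 0"
        unfolding f[OF i] using \<alpha> by (simp add: scaleR_left_distrib scaleR_left_diff_distrib sum.distrib sum_subtractf)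
    qed
    moreover have "(\<forall>i\<in>{1..k}. (\<Sum>j<d. c j *\<^sub>R b j i) = 0) \<longrightarrow> (\<forall>j<d. c j = 0)" for c :: "nat \<Rightarrow> real"
      using b unfolding lattice_basis_def by blast
    from this[of "\<lambda>j. real_of_int (z j) - real_of_int (w j)"]
    have "(\<forall>i\<in>{1..k}. (\<Sum>j<d. (real_of_int (z j) - real_of_int (w j)) *\<^sub>R b j i) = 0) \<longrightarrow>
        (\<forall>j<d. real_of_int (z j) - real_of_int (w j) = 0)" .
    ultimately have "\<forall>j<d. z j = w j" by simp
    then show "z = w"
      using z w unfolding Z_def by (intro PiE_ext[of z "{..<d}" "\<lambda>_. UNIV"]) auto
  qed
  then have "card (code P R k L XR) = card Z"
    unfolding code by (rule card_image)
  moreover have "XR \<in> block_space k"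
    by (simp add: XR_def block_space_def)
  ultimately show ?thesis
    using card_Z unfolding good_shift_def by (intro exI[of _ XR]) simp
qed

section \<open>Decoding errors\<close>

lemma lattice_diff:
  assumes "is_lattice k d L" and "X \<in> L" and "Y \<in> L"
  shows "(\<lambda>i\<in>{1..k}. X i - Y i) \<in> L"
proof -
  obtain b where L: "L = {\<lambda>i\<in>{1..k}. \<Sum>j<d. real_of_int (z j) *\<^sub>R b j i | z :: nat \<Rightarrow> int. True}"
    using assms(1) unfolding is_lattice_def lattice_basis_def by blast
  obtain z w :: "nat \<Rightarrow> int" where "X = (\<lambda>i\<in>{1..k}. \<Sum>j<d. real_of_int (z j) *\<^sub>R b j i)"
    and "Y = (\<lambda>i\<in>{1..k}. \<Sum>j<d. real_of_int (w j) *\<^sub>R b j i)"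
    using assms(2,3) unfolding L by blast
  then have "(\<lambda>i\<in>{1..k}. X i - Y i) = (\<lambda>i\<in>{1..k}. \<Sum>j<d. real_of_int (z j - w j) *\<^sub>R b j i)"
    by (intro restrict_ext) (simp add: scaleR_left_diff_distrib sum_subtractf)
  then show ?thesis
    unfolding L mem_Collect_eq by (intro exI[of _ "\<lambda>j. z j - w j"] conjI TrueI)
qed

lemma cmod_pdet_ge_det_min:
  assumes "X \<in> L" and "X \<noteq> zero_block k"
  shows "det_min k L \<le> cmod (pdet k X)"
  unfolding det_min_def using assms by (intro cINF_lower bdd_belowI[of _ 0]) auto

lemma matrix_mult_add_scaleR:
  fixes A :: "complex^'n::finite^'r::finite"
  shows "A ** (B + c *\<^sub>R C) = A ** B + c *\<^sub>R (A ** C)"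
  by (simp add: matrix_matrix_mult_def Finite_Cartesian_Product.vec_eq_iff scaleR_sum_right
      ring_distribs sum.distrib)

text \<open>Replacing \<open>X\<close> by \<open>X\<close> + \<alpha> v changes the metric by
  \<alpha> (\<alpha> |H v|^2 - 2 <W, H v>), which \<open>strict\<close> makes positive. The search
  set \<open>S\<close> is arbitrary between {\<open>X\<close>} and the shifted lattice.\<close>

lemma min_decoder_correct:
  fixes L :: "'n::finite blocks set" and h :: "('n, 'r::finite) rblocks"
  assumes L: "is_lattice k d L" and S: "S \<subseteq> shifted_lattice P R k L XR" and X: "X \<in> S"
    and D: "min_decoder k S D" and h: "h \<in> block_space k" and \<alpha>: "0 < scaling P R k L"
    and strict: "\<And>l. l \<in> L \<Longrightarrow> l \<noteq> zero_block k \<Longrightarrow>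
      2 * (\<Sum>i=1..k. noise_block w i \<bullet> (h i ** l i)) < scaling P R k L * (\<Sum>i=1..k. (norm (h i ** l i))\<^sup>2)"
  shows "D (h, channel_output k h w X) = X"
proof -
  define a where "a = scaling P R k L"
  let ?y = "channel_output k h w X"
  let ?f = "decoding_metric k h ?y"
  have less: "?f X < ?f X'" if X': "X' \<in> S" "X' \<noteq> X" for X'
  proof -
    obtain l where l: "l \<in> L" "X = (\<lambda>i\<in>{1..k}. XR i + a *\<^sub>R l i)"
      using S X by (auto simp: shifted_lattice_def a_def)
    obtain l' where l': "l' \<in> L" "X' = (\<lambda>i\<in>{1..k}. XR i + a *\<^sub>R l' i)"
      using S X' by (auto simp: shifted_lattice_def a_def)
    define v where "v = (\<lambda>i\<in>{1..k}. l' i - l i)"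
    have X'_eq: "X' i = X i + a *\<^sub>R v i" if "i \<in> {1..k}" for i
      using that by (simp add: l l' v_def scaleR_diff_right)
    have "v \<in> L"
      unfolding v_def by (rule lattice_diff[OF L l'(1) l(1)])
    moreover have "v \<noteq> zero_block k"
    proof
      assume v: "v = zero_block k"
      have "v i = 0" if "i \<in> {1..k}" for i
        using that unfolding v by (simp add: zero_block_def)
      then have "l' i = l i" if "i \<in> {1..k}" for i
        using that by (simp add: v_def split: if_splits)
      then have "X' = X"
        unfolding l l' by (intro restrict_ext) simp
      with X'(2) show False by simp
    qed
    ultimately have v: "2 * (\<Sum>i=1..k. noise_block w i \<bullet> (h i ** v i)) < a * (\<Sum>i=1..k. (norm (h i ** v i))\<^sup>2)"
      unfolding a_def by (rule strict)
    have y: "?y i = h i ** X i + noise_block w i" if "i \<in> {1..k}" for i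
      using that by (simp add: channel_output_def noise_block_def)
    have "?f X' = (\<Sum>i=1..k. (norm (noise_block w i - a *\<^sub>R (h i ** v i)))\<^sup>2)"
      unfolding decoding_metric_def
      by (intro sum.cong refl) (simp add: y X'_eq matrix_mult_add_scaleR del: atLeastAtMost_iff)
    also have "\<dots> = (\<Sum>i=1..k. (norm (noise_block w i))\<^sup>2 - 2 * a * (noise_block w i \<bullet> (h i ** v i)) +
        a\<^sup>2 * (norm (h i ** v i))\<^sup>2)"
      by (intro sum.cong refl)
        (simp only: power2_norm_eq_inner, simp add: inner_diff_left inner_diff_right inner_commute
          power2_eq_square algebra_simps)
    also have "\<dots> = (\<Sum>i=1..k. (norm (noise_block w i))\<^sup>2) +
        a * (a * (\<Sum>i=1..k. (norm (h i ** v i))\<^sup>2) - 2 * (\<Sum>i=1..k. noise_block w i \<bullet> (h i ** v i)))"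
      by (simp add: sum.distrib sum_subtractf sum_distrib_left power2_eq_square algebra_simps)
    also have "(\<Sum>i=1..k. (norm (noise_block w i))\<^sup>2) = ?f X"
      unfolding decoding_metric_def by (intro sum.cong refl) (simp add: y del: atLeastAtMost_iff)
    finally show ?thesis
      using v \<alpha> by (simp add: a_def)
  qed
  have y: "?y \<in> block_space k"
    by (simp add: channel_output_def block_space_def)
  \<comment> \<open>\<open>X\<close> itself witnesses that a minimizer exists, so the decoder is
    bound to return one, and strictness makes it unique.\<close>
  have "is_arg_min ?f (\<lambda>X'. X' \<in> S) X"
    unfolding is_arg_min_def using X less by (metis less_asym less_irrefl)
  then have "is_arg_min ?f (\<lambda>X'. X' \<in> S) (D (h, ?y))"
    using D h y unfolding min_decoder_def by blast
  then show ?thesis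
    unfolding is_arg_min_def using X less by blast
qed

text \<open>
  The event \<open>E\<close> need not be measurable: otherwise its \<^const>\<open>measure\<close> is \<open>0\<close>. Likewise \<open>B\<close> need not
  depend measurably on \<open>\<omega>\<close>, which spares a measurable choice of bases of the ranges of the fading.
\<close>

lemma measure_triple_product_le:
  assumes M: "prob_space M" and N: "prob_space N" and Q: "prob_space Q"
    and A: "A \<in> sets M" and \<delta>: "0 \<le> \<delta>"
    and good: "\<And>\<omega>. \<omega> \<in> space M \<Longrightarrow> \<omega> \<notin> A \<Longrightarrow>
      \<exists>B\<in>sets N. measure N B \<le> \<delta> \<and> (\<forall>w\<in>space N. \<forall>X\<in>space Q. E (\<omega>, w, X) \<longrightarrow> w \<in> B)"
  shows "measure (M \<Otimes>\<^sub>M N \<Otimes>\<^sub>M Q) {p \<in> space (M \<Otimes>\<^sub>M N \<Otimes>\<^sub>M Q). E p} \<le> measure M A + \<delta>"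
proof -
  interpret M: prob_space M by fact
  interpret N: prob_space N by fact
  interpret Q: prob_space Q by fact
  interpret NQ: pair_prob_space N Q ..
  interpret P: pair_prob_space M "N \<Otimes>\<^sub>M Q" ..
  let ?S = "{p \<in> space (M \<Otimes>\<^sub>M N \<Otimes>\<^sub>M Q). E p}"
  show ?thesis
  proof (cases "?S \<in> sets (M \<Otimes>\<^sub>M N \<Otimes>\<^sub>M Q)")
    case False
    then show ?thesis
      using \<delta> by (simp add: measure_notin_sets add_nonneg_nonneg)
  next
    case True
    have "emeasure (M \<Otimes>\<^sub>M N \<Otimes>\<^sub>M Q) ?S = (\<integral>\<^sup>+ \<omega>. emeasure (N \<Otimes>\<^sub>M Q) (Pair \<omega> -` ?S) \<partial>M)"
      by (rule NQ.emeasure_pair_measure_alt[OF True])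
    also have "\<dots> \<le> (\<integral>\<^sup>+ \<omega>. indicator A \<omega> + ennreal \<delta> \<partial>M)"
    proof (rule nn_integral_mono)
      fix \<omega> assume \<omega>: "\<omega> \<in> space M"
      show "emeasure (N \<Otimes>\<^sub>M Q) (Pair \<omega> -` ?S) \<le> indicator A \<omega> + ennreal \<delta>"
      proof (cases "\<omega> \<in> A")
        case True
        have "emeasure (N \<Otimes>\<^sub>M Q) (Pair \<omega> -` ?S) \<le> 1"
          by (rule NQ.measure_le_1)
        then show ?thesis
          using True by (simp add: add_increasing2)
      next
        case False
        from good[OF \<omega> False] obtain B where B: "B \<in> sets N" "measure N B \<le> \<delta>"
          "\<And>w X. w \<in> space N \<Longrightarrow> X \<in> space Q \<Longrightarrow> E (\<omega>, w, X) \<Longrightarrow> w \<in> B"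
          by blast
        have "emeasure (N \<Otimes>\<^sub>M Q) (Pair \<omega> -` ?S) \<le> emeasure (N \<Otimes>\<^sub>M Q) (B \<times> space Q)"
          using B by (intro emeasure_mono) (auto simp: space_pair_measure)
        also have "\<dots> = emeasure N B"
          using B by (simp add: Q.emeasure_pair_measure_Times Q.emeasure_space_1)
        also have "\<dots> \<le> ennreal \<delta>"
          using B(2) by (simp add: N.emeasure_eq_measure ennreal_leI)
        finally show ?thesis
          by (simp add: add_increasing)
      qed
    qed
    also have "\<dots> = emeasure M A + ennreal \<delta>"
      using A by (simp add: nn_integral_add M.emeasure_space_1)
    also have "\<dots> = ennreal (measure M A + \<delta>)"
      using \<delta> by (simp add: M.emeasure_eq_measure)
    finally show ?thesis
      using \<delta> by (simp add: P.emeasure_eq_measure del: ennreal_plus)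
  qed
qed

section \<open>Asymptotics of the normalising constant\<close>

text \<open>Stirling's upper bound up to a polynomial factor, which an N-th root removes in the
  limit. The induction step amounts to e <= (1 + 1/N)^(N+1), and at N = 1 there is equality.\<close>

lemma fact_le_power: "N > 0 \<Longrightarrow> fact N \<le> exp 1 * real N * (real N / exp 1) ^ N"
proof (induction N rule: nat_induct_non_zero)
  case (Suc N)
  have "exp 1 \<le> (1 + 1 / real N) ^ Suc N"
  proof -
    have "1 / (1 + real N) \<le> ln (1 + 1 / real N)"
    proof -
      have "ln (real N / (1 + real N)) \<le> real N / (1 + real N) - 1"
        using Suc by (intro ln_le_minus_one) simp
      moreover have "ln (real N / (1 + real N)) = - ln (1 + 1 / real N)"
        using Suc by (subst ln_inverse[symmetric]) (simp_all add: field_simps)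
      moreover have "real N / (1 + real N) - 1 = - (1 / (1 + real N))"
        by (simp add: field_simps)
      ultimately show ?thesis by linarith
    qed
    then have "1 \<le> real (Suc N) * ln (1 + 1 / real N)"
      by (simp add: field_simps)
    then have "exp 1 \<le> exp (real (Suc N) * ln (1 + 1 / real N))"
      by (simp only: exp_le_cancel_iff)
    also have "\<dots> = (1 + 1 / real N) ^ Suc N"
      using Suc by (subst exp_of_nat_mult) (simp add: add_pos_nonneg)
    finally show ?thesis .
  qed
  also have "1 + 1 / real N = real (Suc N) / real N"
    using Suc by (simp add: field_simps)
  finally have e: "exp 1 * real N ^ Suc N \<le> real (Suc N) ^ Suc N"
    using Suc by (simp add: power_divide pos_le_divide_eq)
  have "fact (Suc N) \<le> real (Suc N) * (exp 1 * real N * (real N / exp 1) ^ N)"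
    using Suc by (simp add: mult_left_mono del: of_nat_Suc)
  also have "\<dots> = real (Suc N) * (exp 1 * real N ^ Suc N) / exp 1 ^ N"
    by (simp add: power_divide)
  also have "\<dots> \<le> real (Suc N) * real (Suc N) ^ Suc N / exp 1 ^ N"
    using e by (intro divide_right_mono mult_left_mono) auto
  also have "\<dots> = exp 1 * real (Suc N) * (real (Suc N) / exp 1) ^ Suc N"
    by (simp add: power_divide del: of_nat_Suc)
  finally show ?case .
qed simp

text \<open>pi n k divided by N / e is pi e / n; the denominator (e N)^(1/N) is the price of the
  factor e N in the factorial bound.\<close>

lemma C_nk_root_ge:
  assumes n: "n > 0" and k: "k > 0"
  defines "N \<equiv> real n ^ 2 * real k"
  shows "pi * exp 1 / (real n * (exp 1 * N) powr (1 / N)) \<le> C_nk n k powr (1 / N)"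
proof -
  define m where "m = n\<^sup>2 * k"
  have m: "N = real m" "m > 0" using n k by (auto simp: N_def m_def)
  have root: "(t ^ m) powr (1 / N) = t" if "t > 0" for t :: real
    using that m by (simp add: powr_realpow[symmetric] powr_powr)
  have "pi * exp 1 / (real n * (exp 1 * N) powr (1 / N)) =
      (pi * real n * real k) / ((exp 1 * N) powr (1 / N) * (N / exp 1))"
    using n k by (simp add: N_def power2_eq_square)
  also have "\<dots> = ((pi * real n * real k) ^ m) powr (1 / N) / ((exp 1 * N) powr (1 / N) * ((N / exp 1) ^ m) powr (1 / N))"
  proof -
    have "((pi * real n * real k) ^ m) powr (1 / N) = pi * real n * real k"
      using n k by (intro root) simp
    moreover have "((N / exp 1) ^ m) powr (1 / N) = N / exp 1"
      using m by (intro root) simp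
    ultimately show ?thesis by (simp only:)
  qed
  also have "\<dots> = ((pi * real n * real k) ^ m / (exp 1 * N * (N / exp 1) ^ m)) powr (1 / N)"
    using n k m by (simp add: powr_divide powr_mult)
  also have "\<dots> \<le> C_nk n k powr (1 / N)"
    unfolding C_nk_def m_def[symmetric]
    using n k m fact_le_power[OF m(2)]
    by (intro powr_mono2 divide_left_mono) (auto simp: m mult.assoc)
  finally show ?thesis .
qed

lemma eventually_root_le:
  fixes c \<rho> :: real
  assumes "c > 0" and "\<rho> > 1"
  shows "eventually (\<lambda>k. (exp 1 * (c * real k)) powr (1 / (c * real k)) \<le> \<rho>) sequentially"
proof -
  have "(\<lambda>k. (exp 1 * (c * real k)) powr (1 / (c * real k))) \<longlonglongrightarrow> 1"
    using assms(1) by real_asymp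
  then have "eventually (\<lambda>k. (exp 1 * (c * real k)) powr (1 / (c * real k)) < \<rho>) sequentially"
    using assms(2) by (rule order_tendstoD)
  then show ?thesis
    by (rule eventually_mono) simp
qed

lemma measurable_det_gram:
  "(\<lambda>A :: complex^'n::finite^'r::finite. Re (det (gram A))) \<in> borel_measurable borel"
proof -
  have [continuous_intros]: "continuous_on UNIV (\<lambda>A :: complex^'n^'r. A $ i $ j)" for i j
    by (intro continuous_intros)
  have "continuous_on UNIV (\<lambda>A :: complex^'n^'r. Re (det (gram A)))"
    unfolding Determinants.det_def gram_nth by (intro continuous_intros)
  then show ?thesis
    by (rule borel_measurable_continuous_onI)
qed

section \<open>Error bound for a fixed number of blocks, and its limit\<close>

text \<open>An error requires atypical fading or projected noise above \<rho> times n^2 k. Off these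
  events, \<open>large\<close> lets the lattice distance win over the noise for every
  competitor.\<close>

lemma error_prob_le:
  fixes M :: "'w measure"
    and H :: "int \<Rightarrow> 'w \<Rightarrow> complex^'n::finite^'r::finite"
    and L :: "'n blocks set"
  assumes M: "prob_space M"
    and H: "\<And>i. H i \<in> borel_measurable M"
    and rank: "\<And>i. AE \<omega> in M. rank (H i \<omega>) = CARD('n)"
    and P: "P > 0" and k: "k > 0" and \<rho>: "\<rho> > 1"
    and L: "is_lattice k (2 * CARD('n)\<^sup>2 * k) L" and det_min: "det_min k L = 1"
    and large: "4 * real CARD('n) * \<rho> \<le> (scaling P R k L)\<^sup>2 * 2 powr ((\<mu> - \<epsilon>) / real CARD('n))"
    and shift: "good_shift P R k L XR"
    and S: "code P R k L XR \<subseteq> S" "S \<subseteq> shifted_lattice P R k L XR"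
    and D: "min_decoder k S D"
  defines "c \<equiv> (real CARD('r) * real CARD('n))\<^sup>2 * (\<integral>z. (norm z) ^ 4 \<partial>complex_gaussian)"
  shows "error_prob M H k (code P R k L XR) D \<le>
    \<P>(\<omega> in M. \<bar>(1 / real k) * (\<Sum>i=1..k. log 2 (Re (det
            (conj_transpose (H (int i) \<omega>) ** H (int i) \<omega>)))) - \<mu>\<bar> > \<epsilon>) +
    real k * c / (real k * (real CARD('n))\<^sup>2 * (\<rho> - 1))\<^sup>2"
proof -
  interpret prob_space M by fact
  let ?n = "real CARD('n)"
  let ?C = "code P R k L XR"
  define a where "a = scaling P R k L"
  \<comment> \<open>Typical fading has determinant product at least 2^(k (\<mu> - \<epsilon>)),
    which is T^(nk).\<close>
  define T where "T = 2 powr ((\<mu> - \<epsilon>) / ?n)"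
  \<comment> \<open>Chosen so that the mean bound k n^2 plus \<open>t\<close> equals \<rho> k
    n^2.\<close>
  define t where "t = real k * ?n\<^sup>2 * (\<rho> - 1)"
  define g where "g i \<omega> = Re (det (gram (H (int i) \<omega>)))" for i \<omega>
  define bad where "bad = {\<omega> \<in> space M. \<bar>(1 / real k) * (\<Sum>i=1..k. log 2 (g i \<omega>)) - \<mu>\<bar> > \<epsilon>}"
  have a: "0 < a"
    unfolding a_def by (rule scaling_square(2)[OF P k L])
  have T: "0 < T" by (simp add: T_def)
  have t: "0 < t" using k \<rho> by (simp add: t_def)
  have c: "0 \<le> c" by (simp add: c_def)
  have [measurable]: "g i \<in> borel_measurable M" for i
    unfolding g_def by (rule measurable_compose[OF H measurable_det_gram])
  have bad: "bad \<in> sets M"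
    unfolding bad_def by measurable
  have "AE \<omega> in M. \<forall>i\<in>{1..k}. rank (H (int i) \<omega>) = CARD('n)"
    using rank by (subst AE_finite_all) auto
  then obtain N0 where N0: "N0 \<in> null_sets M"
    "{\<omega> \<in> space M. \<not> (\<forall>i\<in>{1..k}. rank (H (int i) \<omega>) = CARD('n))} \<subseteq> N0"
    by (rule AE_E3) blast
  \<comment> \<open>An infinite set has \<open>card\<close> 0, so a positive lower bound on
    \<open>card\<close> gives both finiteness and non-emptiness; these make the uniform choice of
    codeword a probability measure.\<close>
  have "0 < 2 powr (R * ?n * real k)" by simp
  with shift have "0 < card ?C"
    unfolding good_shift_def by (metis less_le_trans of_nat_0_less_iff)
  then have C: "finite ?C" "?C \<noteq> {}"
    by (auto simp: card_gt_0_iff)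
  have "measure (M \<Otimes>\<^sub>M noise k \<Otimes>\<^sub>M uniform_count_measure ?C)
      {p \<in> space (M \<Otimes>\<^sub>M noise k \<Otimes>\<^sub>M uniform_count_measure ?C). case p of (\<omega>, w, X) \<Rightarrow>
        let h = (\<lambda>i\<in>{1..k}. H (int i) \<omega>) in D (h, channel_output k h w X) \<noteq> X}
      \<le> measure M (bad \<union> N0) + real k * c / t\<^sup>2"
  proof (rule measure_triple_product_le[OF M prob_space_noise prob_space_uniform_count_measure[OF C]])
    show "bad \<union> N0 \<in> sets M" using bad N0(1) by auto
    show "0 \<le> real k * c / t\<^sup>2" using c by simp
    fix \<omega> assume \<omega>: "\<omega> \<in> space M" "\<omega> \<notin> bad \<union> N0"
    define h where "h = (\<lambda>i\<in>{1..k}. H (int i) \<omega>)"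
    have "\<forall>i\<in>{1..k}. rank (H (int i) \<omega>) = CARD('n)"
      using \<omega> N0(2) by blast
    \<comment> \<open>Positivity is what makes 2 to the sum of logarithms the product of
      determinants; \<open>log 2 0\<close> is 0 and would break that identity.\<close>
    then have g: "0 < g i \<omega>" if "i \<in> {1..k}" for i
      unfolding g_def using that by (intro det_gram_pos) blast
    have "T ^ (CARD('n) * k) = 2 powr (real k * (\<mu> - \<epsilon>))"
      by (simp add: T_def powr_realpow[symmetric] powr_powr mult.commute)
    also have "\<dots> \<le> 2 powr (\<Sum>i=1..k. log 2 (g i \<omega>))"
    proof -
      have "\<bar>(1 / real k) * (\<Sum>i=1..k. log 2 (g i \<omega>)) - \<mu>\<bar> \<le> \<epsilon>"
        using \<omega> by (simp add: bad_def)
      then have "\<mu> - \<epsilon> \<le> (1 / real k) * (\<Sum>i=1..k. log 2 (g i \<omega>))"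
        by linarith
      then show ?thesis
        using k by (simp add: field_simps)
    qed
    also have "\<dots> = (\<Prod>i=1..k. g i \<omega>)"
      unfolding powr_sum[OF zero_neq_numeral[symmetric]]
      by (intro prod.cong refl powr_log_cancel g) auto
    also have "\<dots> = (\<Prod>i=1..k. Re (det (gram (h i))))"
      by (intro prod.cong refl) (simp add: h_def g_def)
    finally have T_le: "T ^ (CARD('n) * k) \<le> (\<Prod>i=1..k. Re (det (gram (h i))))" .
    obtain Z :: "(nat \<times> 'r \<times> 'n \<Rightarrow> complex) \<Rightarrow> real" where Z: "Z \<in> borel_measurable (noise k)"
      "\<And>w (l :: 'n blocks). (\<Sum>i=1..k. noise_block w i \<bullet> (h i ** l i))\<^sup>2 \<le> Z w * (\<Sum>i=1..k. (norm (h i ** l i))\<^sup>2)"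
      "\<And>t. 0 < t \<Longrightarrow> measure (noise k) {w \<in> space (noise k). real k * (real CARD('n))\<^sup>2 + t \<le> Z w}
        \<le> real k * c / t\<^sup>2"
      by (rule noise_projection_tail[OF k, of h, folded c_def]) (rule that)
    define B where "B = {w \<in> space (noise k). real k * ?n\<^sup>2 + t \<le> Z w}"
    have "B \<in> sets (noise k)"
      unfolding B_def using Z(1) by measurable
    moreover have "measure (noise k) B \<le> real k * c / t\<^sup>2"
      unfolding B_def by (rule Z(3)[OF t])
    moreover have "D (h, channel_output k h w X) = X"
      if w: "w \<in> space (noise k)" "w \<notin> B" and X: "X \<in> ?C" for w X
    proof (rule min_decoder_correct[OF L S(2) _ D])
      show "X \<in> S" using X S(1) by blast
      show "h \<in> block_space k" by (simp add: h_def block_space_def)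
      show "0 < scaling P R k L" using a by (simp add: a_def)
      fix l assume l: "l \<in> L" "l \<noteq> zero_block k"
      let ?q = "\<Sum>i=1..k. (norm (h i ** l i))\<^sup>2"
      have "1 \<le> cmod (pdet k l)"
        using cmod_pdet_ge_det_min[OF l] det_min by simp
      then have q: "?n * real k * T \<le> ?q"
        by (rule norm_sum_mult_ge[OF T _ T_le])
      moreover have "0 < ?n * real k * T" using k T by simp
      ultimately have q0: "0 < ?q" by linarith
      \<comment> \<open>Comparison of squares: one factor of q comes from Cauchy-Schwarz, and n k T
        is then traded for a second one through \<open>q\<close>. Only the right-hand side has to be
        nonnegative to take roots.\<close>
      have "(2 * (\<Sum>i=1..k. noise_block w i \<bullet> (h i ** l i)))\<^sup>2 \<le> 4 * (Z w * ?q)"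
        using Z(2)[of w l] by (simp add: power_mult_distrib)
      also have "Z w < real k * ?n\<^sup>2 * \<rho>"
        using w by (simp add: B_def t_def algebra_simps)
      then have "4 * (Z w * ?q) < 4 * (real k * ?n\<^sup>2 * \<rho> * ?q)"
        using q0 by simp
      also have "\<dots> = (4 * ?n * \<rho>) * (real k * ?n * ?q)"
        by (simp add: power2_eq_square)
      also have "\<dots> \<le> (a\<^sup>2 * T) * (real k * ?n * ?q)"
        using large q0 unfolding a_def T_def by (intro mult_right_mono) auto
      also have "\<dots> = a\<^sup>2 * ?q * (?n * real k * T)"
        by simp
      also have "\<dots> \<le> a\<^sup>2 * ?q * ?q"
        using q q0 by (intro mult_left_mono) auto
      also have "\<dots> = (a * ?q)\<^sup>2"
        by (simp add: power2_eq_square)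
      finally show "2 * (\<Sum>i=1..k. noise_block w i \<bullet> (h i ** l i)) < scaling P R k L * ?q"
        unfolding a_def[symmetric] by (rule power2_less_imp_less) (use a q0 in simp)
    qed
    moreover have "space (uniform_count_measure ?C) = ?C"
      by (rule space_uniform_count_measure)
    ultimately show "\<exists>B\<in>sets (noise k). measure (noise k) B \<le> real k * c / t\<^sup>2 \<and>
        (\<forall>w\<in>space (noise k). \<forall>X\<in>space (uniform_count_measure ?C).
          (case (\<omega>, w, X) of (\<omega>, w, X) \<Rightarrow>
            let h = (\<lambda>i\<in>{1..k}. H (int i) \<omega>) in D (h, channel_output k h w X) \<noteq> X) \<longrightarrow> w \<in> B)"
      unfolding h_def Let_def prod.case by blast
  qed
  also have "measure M (bad \<union> N0) = measure M bad"
    by (rule measure_Un_null_set[OF bad N0(1)])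
  finally show ?thesis
    unfolding error_prob_def bad_def g_def gram_def t_def by (simp only: split_beta' prod.collapse)
qed

text \<open>Combines the factorial bound with the covolume bound; apart from the correction (e
  N)^(1/N) the left side is independent of \<open>k\<close>.\<close>

lemma scaling_square_ge:
  fixes L :: "'n::finite blocks set"
  assumes P: "P > 0" and k: "k > 0" and C: "C > 0"
    and L: "is_lattice k (2 * CARD('n)\<^sup>2 * k) L"
    and vol: "lattice_vol k (2 * CARD('n)\<^sup>2 * k) L powr (1 / (real CARD('n) ^ 2 * real k)) \<le> C"
  defines "N \<equiv> real CARD('n) ^ 2 * real k"
  shows "pi * exp 1 * P / (real CARD('n) * (2 powr (R / real CARD('n)) * C)) / (exp 1 * N) powr (1 / N)
    \<le> (scaling P R k L)\<^sup>2"
proof -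
  let ?n = "real CARD('n)"
  let ?v = "lattice_vol k (2 * CARD('n)\<^sup>2 * k) L powr (1 / N)"
  have v: "0 < ?v" using lattice_vol_pos[OF L] by simp
  have N: "0 < N" using k by (simp add: N_def)
  have "pi * exp 1 * P / (?n * (2 powr (R / ?n) * C)) / (exp 1 * N) powr (1 / N) =
      (pi * exp 1 / (?n * (exp 1 * N) powr (1 / N))) * P / (2 powr (R / ?n) * C)"
    by simp
  also have "\<dots> \<le> C_nk CARD('n) k powr (1 / N) * P / (2 powr (R / ?n) * C)"
    using P C C_nk_root_ge[of "CARD('n)" k] k unfolding N_def
    by (intro divide_right_mono mult_right_mono) auto
  also have "\<dots> \<le> C_nk CARD('n) k powr (1 / N) * P / (2 powr (R / ?n) * ?v)"
  proof (rule divide_left_mono)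
    show "2 powr (R / ?n) * ?v \<le> 2 powr (R / ?n) * C"
      using vol unfolding N_def by (rule mult_left_mono) simp
    show "0 \<le> C_nk CARD('n) k powr (1 / N) * P"
      using P by simp
    show "0 < 2 powr (R / ?n) * C * (2 powr (R / ?n) * ?v)"
      by (intro mult_pos_pos C v) simp_all
  qed
  also have "\<dots> = (scaling P R k L)\<^sup>2"
    unfolding scaling_square(1)[OF P k L] N_def ..
  finally show ?thesis .
qed

text \<open>Stated for any search set between the code and the shifted lattice, whose two extremes
  are the two decoders.\<close>

lemma achievable_by_min_decoder:
  fixes M :: "'w measure"
    and H :: "int \<Rightarrow> 'w \<Rightarrow> complex^'n::finite^'r::finite"
    and L :: "nat \<Rightarrow> 'n blocks set"
    and K :: "nat set"
    and \<mu> C\<^sub>L P R :: real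
  assumes M: "prob_space M"
    and H: "\<And>i. H i \<in> borel_measurable M"
    and rank: "\<And>i. AE \<omega> in M. rank (H i \<omega>) = CARD('n)"
    and lln: "\<And>\<epsilon>. \<epsilon> > 0 \<Longrightarrow>
      (\<lambda>k. \<P>(\<omega> in M.
        \<bar>(1 / real k) * (\<Sum>i=1..k. log 2 (Re (det
            (conj_transpose (H (int i) \<omega>) ** H (int i) \<omega>)))) - \<mu>\<bar> > \<epsilon>))
      \<longlonglongrightarrow> 0"
    and K: "0 \<notin> K"
    and C\<^sub>L: "C\<^sub>L > 0"
    and L: "\<And>k. k \<in> K \<Longrightarrow> is_lattice k (2 * CARD('n)\<^sup>2 * k) (L k)"
    and det_min: "\<And>k. k \<in> K \<Longrightarrow> det_min k (L k) = 1"
    and vol: "\<And>k. k \<in> K \<Longrightarrow>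
      lattice_vol k (2 * CARD('n)\<^sup>2 * k) (L k) powr (1 / (real CARD('n) ^ 2 * real k)) \<le> C\<^sub>L"
    and P: "P > 0"
    and R: "R < \<mu> + real CARD('n) *
      (log 2 P - log 2 C\<^sub>L + log 2 (pi * exp 1 / (4 * real CARD('n) ^ 2)))"
    and S: "\<And>k XR. code P R k (L k) XR \<subseteq> S k XR" "\<And>k XR. S k XR \<subseteq> shifted_lattice P R k (L k) XR"
  shows "achievable_by M H P K L S R"
  unfolding achievable_by_def
proof (intro conjI ballI allI impI)
  show "\<exists>XR. good_shift P R k (L k) XR" if "k \<in> K" for k
    using that K by (intro ex_good_shift P L) (auto intro: gr0I)
  let ?n = "real CARD('n)"
  define c where "c = (real CARD('r) * real CARD('n))\<^sup>2 * (\<integral>z. (norm z) ^ 4 \<partial>complex_gaussian)"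
  define R0 where "R0 = \<mu> + ?n * (log 2 P - log 2 C\<^sub>L + log 2 (pi * exp 1 / (4 * ?n ^ 2)))"
  \<comment> \<open>Half of the gap to the threshold \<open>R0\<close> is spent on the fluctuation
    of the fading. The other half contributes 2^(\<epsilon>/n) = \<rho>^2: one factor \<rho> pays
    for noise above its mean, the other for the correction (e N)^(1/N).\<close>
  define \<epsilon> where "\<epsilon> = (R0 - R) / 2"
  define \<rho> where "\<rho> = 2 powr (\<epsilon> / (2 * ?n))"
  have \<epsilon>: "\<epsilon> > 0" using R by (simp add: \<epsilon>_def R0_def)
  have \<rho>: "\<rho> > 1" using \<epsilon> by (simp add: \<rho>_def)
  have rate: "4 * ?n * \<rho> * \<rho> =
      pi * exp 1 * P / (?n * (2 powr (R / ?n) * C\<^sub>L)) * 2 powr ((\<mu> - \<epsilon>) / ?n)"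
  proof -
    have "R0 / ?n = \<mu> / ?n + (log 2 P - log 2 C\<^sub>L + log 2 (pi * exp 1 / (4 * ?n ^ 2)))"
      by (simp add: R0_def add_divide_distrib)
    then have "2 powr (R0 / ?n) = 2 powr (\<mu> / ?n) * (P / C\<^sub>L * (pi * exp 1 / (4 * ?n ^ 2)))"
      using P C\<^sub>L by (simp add: powr_add powr_diff)
    moreover have "\<rho> * \<rho> = 2 powr (R0 / ?n) / 2 powr (R / ?n) / 2 powr (\<epsilon> / ?n)"
    proof -
      have sum: "\<epsilon> / (2 * ?n) + \<epsilon> / (2 * ?n) = R0 / ?n - R / ?n - \<epsilon> / ?n"
        by (simp add: \<epsilon>_def field_simps)
      then show ?thesis
        by (simp only: \<rho>_def powr_add[symmetric] sum powr_diff)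
    qed
    ultimately have "\<rho> * \<rho> = 2 powr (\<mu> / ?n) * (P / C\<^sub>L * (pi * exp 1 / (4 * ?n ^ 2))) /
        2 powr (R / ?n) / 2 powr (\<epsilon> / ?n)"
      by (simp only:)
    moreover have "2 powr ((\<mu> - \<epsilon>) / ?n) = 2 powr (\<mu> / ?n) / 2 powr (\<epsilon> / ?n)"
      by (simp only: diff_divide_distrib powr_diff)
    \<comment> \<open>The remaining identity is pure field arithmetic; the powers and exponentials
      are abstracted into variables so that simplification does not rewrite them.\<close>
    moreover have "4 * n * (E * (P / C * (q / (4 * n ^ 2))) / r / e) = q * P / (n * (r * C)) * (E / e)"
      if "n \<noteq> 0" for n E P C q r e :: real
      using that by (simp add: power2_eq_square mult_ac)
    ultimately show ?thesis
      by (simp only: mult.assoc[of "4 * ?n" \<rho>]) simp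
  qed
  fix XR and D :: "nat \<Rightarrow> ('n, 'r) rblocks \<times> ('n, 'r) rblocks \<Rightarrow> 'n blocks"
  assume ass: "\<forall>k\<in>K. good_shift P R k (L k) (XR k) \<and> min_decoder k (S k (XR k)) (D k)"
  define p where "p k = \<P>(\<omega> in M.
      \<bar>(1 / real k) * (\<Sum>i=1..k. log 2 (Re (det
          (conj_transpose (H (int i) \<omega>) ** H (int i) \<omega>)))) - \<mu>\<bar> > \<epsilon>)" for k
  define \<delta> where "\<delta> k = real k * c / (real k * ?n\<^sup>2 * (\<rho> - 1))\<^sup>2" for k
  have "eventually (\<lambda>k. (exp 1 * (?n ^ 2 * real k)) powr (1 / (?n ^ 2 * real k)) \<le> \<rho>) sequentially"
    by (rule eventually_root_le) (use \<rho> in auto)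
  then have le: "eventually (\<lambda>k. k \<in> K \<longrightarrow> error_prob M H k (code P R k (L k) (XR k)) (D k) \<le> p k + \<delta> k) sequentially"
  proof (rule eventually_mono, intro impI)
    fix k assume root: "(exp 1 * (?n ^ 2 * real k)) powr (1 / (?n ^ 2 * real k)) \<le> \<rho>" and k: "k \<in> K"
    let ?N = "?n ^ 2 * real k"
    have k0: "k > 0" using k K by (auto intro: gr0I)
    let ?x = "pi * exp 1 * P / (?n * (2 powr (R / ?n) * C\<^sub>L))"
    have "?x / \<rho> \<le> ?x / (exp 1 * ?N) powr (1 / ?N)"
      using P C\<^sub>L k0 root \<rho> by (intro divide_left_mono) auto
    also have "\<dots> \<le> (scaling P R k (L k))\<^sup>2"
      by (rule scaling_square_ge[OF P k0 C\<^sub>L L[OF k] vol[OF k]])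
    finally have "?x / \<rho> * 2 powr ((\<mu> - \<epsilon>) / ?n) \<le> (scaling P R k (L k))\<^sup>2 * 2 powr ((\<mu> - \<epsilon>) / ?n)"
      by (rule mult_right_mono) simp
    moreover have "4 * ?n * \<rho> = ?x / \<rho> * 2 powr ((\<mu> - \<epsilon>) / ?n)"
    proof -
      have "4 * ?n * \<rho> = 4 * ?n * \<rho> * \<rho> / \<rho>"
        using \<rho> by simp
      also have "\<dots> = ?x / \<rho> * 2 powr ((\<mu> - \<epsilon>) / ?n)"
        by (simp only: rate times_divide_eq_left)
      finally show ?thesis .
    qed
    ultimately have "4 * ?n * \<rho> \<le> (scaling P R k (L k))\<^sup>2 * 2 powr ((\<mu> - \<epsilon>) / ?n)"
      by simp
    then show "error_prob M H k (code P R k (L k) (XR k)) (D k) \<le> p k + \<delta> k"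
      unfolding p_def \<delta>_def c_def
      using ass k by (intro error_prob_le[OF M H rank P k0 \<rho> L[OF k] det_min[OF k] _ _ S]) auto
  qed
  \<comment> \<open>A variance of order k against a squared deviation of order k^2 leaves a constant
    times 1/k.\<close>
  have "\<delta> \<longlonglongrightarrow> 0"
  proof -
    have "(\<lambda>k. (c / (?n\<^sup>2 * (\<rho> - 1))\<^sup>2) * (real k / (real k)\<^sup>2)) \<longlonglongrightarrow> (c / (?n\<^sup>2 * (\<rho> - 1))\<^sup>2) * 0"
      by (intro tendsto_mult tendsto_const) real_asymp
    then show ?thesis
      unfolding \<delta>_def by (simp add: power_mult_distrib mult_ac)
  qed
  then have "(\<lambda>k. p k + \<delta> k) \<longlonglongrightarrow> 0"
    using tendsto_add[OF lln[OF \<epsilon>]] unfolding p_def by fastforce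
  then have lim: "((\<lambda>k. p k + \<delta> k) \<longlongrightarrow> 0) (inf sequentially (principal K))"
    by (rule tendsto_mono[OF inf_le1])
  show "((\<lambda>k. error_prob M H k (code P R k (L k) (XR k)) (D k)) \<longlongrightarrow> 0) (inf sequentially (principal K))"
  proof (rule tendsto_sandwich[OF _ _ tendsto_const lim])
    show "\<forall>\<^sub>F k in inf sequentially (principal K). 0 \<le> error_prob M H k (code P R k (L k) (XR k)) (D k)"
      by (simp add: error_prob_def)
    show "\<forall>\<^sub>F k in inf sequentially (principal K).
        error_prob M H k (code P R k (L k) (XR k)) (D k) \<le> p k + \<delta> k"
      using le by (simp add: eventually_inf_principal)
  qed
qed

theorem mainTheorem1:
  fixes M :: "'w measure"
    and H :: "int \<Rightarrow> 'w \<Rightarrow> complex^'n::finite^'r::finite"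
    and L :: "nat \<Rightarrow> 'n blocks set"
    and K :: "nat set"
    and \<mu> C\<^sub>L P R :: real
  assumes "prob_space M"
    and "CARD('n) \<le> CARD('r)"
    and "\<And>i. H i \<in> borel_measurable M"
    and "\<And>i. AE \<omega> in M. rank (H i \<omega>) = CARD('n)"
    and "\<mu> > 0"
    and "\<And>\<epsilon>. \<epsilon> > 0 \<Longrightarrow>
      (\<lambda>k. \<P>(\<omega> in M.
        \<bar>(1 / real k) * (\<Sum>i=1..k. log 2 (Re (Determinants.det
            (conj_transpose (H (int i) \<omega>) ** H (int i) \<omega>)))) - \<mu>\<bar> > \<epsilon>))
      \<longlonglongrightarrow> 0"
    and "infinite K" and "0 \<notin> K"
    and "C\<^sub>L > 0"
    and "\<And>k. k \<in> K \<Longrightarrow> is_lattice k (2 * CARD('n)\<^sup>2 * k) (L k)"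
    and "\<And>k. k \<in> K \<Longrightarrow> det_min k (L k) = 1"
    and "\<And>k. k \<in> K \<Longrightarrow>
      lattice_vol k (2 * CARD('n)\<^sup>2 * k) (L k) powr (1 / (real CARD('n) ^ 2 * real k)) \<le> C\<^sub>L"
    and "P > 0"
    and "R < \<mu> + real CARD('n) *
      (log 2 P - log 2 C\<^sub>L + log 2 (pi * exp 1 / (4 * real CARD('n) ^ 2)))"
  shows "achievable_ML M H P K L R \<and> achievable_NLD M H P K L R"
  unfolding achievable_ML_def achievable_NLD_def
  using assms by (intro conjI achievable_by_min_decoder[where \<mu> = \<mu> and C\<^sub>L = C\<^sub>L]) (auto simp: code_def)

end
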